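(* Assume that $\lambda$ is constant, and that there are a function $M$ on $\Omega$ and a constant $\eta\in\mathbb R$ such that $|\nabla Qf(x)|^2\le M(x)\,Q(|\nabla f|^2)(x)$ for all $f\in\mathcal A$, $x\in\Omega$, and $$\forall (x,u)\in\Omega\times\mathbb R^d,\qquad 2u^*J_b(x)u+\lambda\,(M(x)-1)|u|^2\le-\eta|u|^2 .$$ Then for all $t>0$, $f\in\mathcal A$ and $x\in\Omega$, $$|\nabla P_tf|^2(x)\le e^{-\eta t}\,P_t\big(|\nabla f|^2\big)(x).$$
   Context: Setting. $\Omega\subset\mathbb R^d$ is open, $b:\Omega\to\mathbb R^d$ is a smooth vector field, $\lambda:\Omega\to\mathbb R_+$ is a smooth jump rate, and $Q$ is a Markov transition kernel on $\Omega$, also viewed as the operator $Qf(x)=\int f(y)\,Q(x,dy)$. Let $(\varphi_x(t))_{t\ge0}$ solve $\partial_t\varphi_x(t)=b(\varphi_x(t))$, $\varphi_x(0)=x$. The piecewise deterministic Markov process $(X_t)_{t\ge 0}$ started at $x$ follows the flow $\varphi_x$ until a random time $T_x$ with $\mathbb P(T_x<s)=1-e^{-\int_0^s\lambda(\varphi_x(w))dw}$, then jumps according to the law $Q(\varphi_x(T_x))$, and starts anew from its new position. Its generator is $Lf(x)=b(x)\cdot\nabla f(x)+\lambda(x)(Qf(x)-f(x))$, and its semigroup is $P_tf(x)=\mathbb E(f(X_t)\mid X_0=x)$. Standing assumptions: the flow is well-defined for all $t>0$ and stays in $\Omega$; the process is non-explosive; $\lambda>0$ almost everywhere and at every fixed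 point of the flow; the process has a unique invariant law $\mu$, and $P_tf(x)\to\int f\,d\mu$ as $t\to\infty$ for all $f\in L^2(\mu)$, $x\in\Omega$; all polynomial moments of $\mu$ are finite; with $\mathcal A$ the set of functions in $\mathcal C^\infty(\Omega)$ whose derivatives grow at most polynomially at infinity, $Q$, $L$ and $P_t$ are well-defined on $\mathcal A$ and map $\mathcal A$ to itself. The elementary calculations with functions of $\mathcal A$ (e.g. $\partial_tP_tf=LP_tf=P_tLf$, differentiation under $P_t$ and $\mu$) are taken to be licit. Notation: $J_b(x)=[\partial_ib_k(x)]_{1\le i,k\le d}$; $A^*$ is the transpose of $A$, so $u^*v$ is the scalar product; $|\cdot|$ is the Euclidean norm. *)

theory Defs
  imports "HOL-Probability.Probability"
begin

section \<open>Differential calculus and the class of test functions\<close>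

definition partial :: "'n \<Rightarrow> (real ^ 'n \<Rightarrow> real) \<Rightarrow> real ^ 'n \<Rightarrow> real"
  where "partial i f x = frechet_derivative f (at x) (axis i 1)"

definition grad :: "(real ^ 'n \<Rightarrow> real) \<Rightarrow> real ^ 'n \<Rightarrow> real ^ 'n"
  where "grad f x = (\<chi> i. partial i f x)"

text \<open>Row index is the differentiation variable: the \<open>(i, k)\<close> entry is
  \<open>\<partial>\<^sub>i b\<^sub>k\<close>, i.e. the transpose of the usual Jacobian.\<close>

definition J_mat :: "(real ^ 'n \<Rightarrow> real ^ 'n) \<Rightarrow> real ^ 'n \<Rightarrow> real ^ 'n ^ 'n"
  where "J_mat b x = (\<chi> i k. partial i (\<lambda>y. b y $ k) x)"

definition partials :: "'n list \<Rightarrow> (real ^ 'n \<Rightarrow> real) \<Rightarrow> real ^ 'n \<Rightarrow> real"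
  where "partials is f = foldr partial is f"

definition smooth_on :: "(real ^ 'n) set \<Rightarrow> (real ^ 'n \<Rightarrow> real) \<Rightarrow> bool"
  where "smooth_on \<Omega> f \<longleftrightarrow> (\<forall>is. \<forall>x\<in>\<Omega>. partials is f differentiable (at x))"

text \<open>The class \<open>\<A>\<close>. The empty multi-index is included, so that \<open>f\<close> itself
  grows at most polynomially. Values outside \<open>\<Omega>\<close> are irrelevant.\<close>

definition test_functions :: "(real ^ 'n) set \<Rightarrow> (real ^ 'n \<Rightarrow> real) set"
  where "test_functions \<Omega> =
    {f. smooth_on \<Omega> f \<and>
        (\<forall>is. \<exists>C k. \<forall>x\<in>\<Omega>. \<bar>partials is f x\<bar> \<le> C * (1 + norm x) ^ k)}"

section \<open>The piecewise deterministic Markov process\<close>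

text \<open>\<open>Y n\<close> is the position just after the \<open>n\<close>-th jump (\<open>Y 0\<close> the initial
  position) and \<open>S n\<close> the waiting time, possibly infinite, between jumps \<open>n\<close> and
  \<open>n + 1\<close>.\<close>

definition jump_time :: "(nat \<Rightarrow> 'w \<Rightarrow> ennreal) \<Rightarrow> nat \<Rightarrow> 'w \<Rightarrow> ennreal"
  where "jump_time S n \<omega> = (\<Sum>k<n. S k \<omega>)"

text \<open>The sigma-algebra generated by \<open>Y 0, \<dots>, Y n\<close> and \<open>S 0, \<dots>, S (m - 1)\<close>.\<close>

definition history ::
  "(real ^ 'n) set \<Rightarrow> 'w measure \<Rightarrow> (nat \<Rightarrow> 'w \<Rightarrow> real ^ 'n) \<Rightarrow> (nat \<Rightarrow> 'w \<Rightarrow> ennreal)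
    \<Rightarrow> nat \<Rightarrow> nat \<Rightarrow> 'w measure"
  where "history \<Omega> N Y S n m = sigma (space N)
    ({Y k -` B \<inter> space N | k B. k \<le> n \<and> B \<in> sets (restrict_space borel \<Omega>)} \<union>
     {S k -` B \<inter> space N | k B. k < m \<and> B \<in> sets borel})"

text \<open>Given the past up to jump \<open>n\<close>, the waiting time \<open>S n\<close> has the law of \<open>T\<^sub>y\<close>
  with \<open>y = Y n\<close>; given in addition \<open>S n < \<infinity>\<close>, the next position has law
  \<open>Q (\<phi>\<^sub>y (S n))\<close>.\<close>

definition jump_chain ::
  "(real ^ 'n) set \<Rightarrow> (real ^ 'n \<Rightarrow> real) \<Rightarrow> (real ^ 'n \<Rightarrow> (real ^ 'n) measure)
    \<Rightarrow> (real ^ 'n \<Rightarrow> real \<Rightarrow> real ^ 'n) \<Rightarrow> real ^ 'n \<Rightarrow> 'w measure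
    \<Rightarrow> (nat \<Rightarrow> 'w \<Rightarrow> real ^ 'n) \<Rightarrow> (nat \<Rightarrow> 'w \<Rightarrow> ennreal) \<Rightarrow> bool"
  where "jump_chain \<Omega> lam Q \<phi> x N Y S \<longleftrightarrow>
    prob_space N \<and>
    (\<forall>n. Y n \<in> N \<rightarrow>\<^sub>M restrict_space borel \<Omega>) \<and>
    (\<forall>n. S n \<in> borel_measurable N) \<and>
    (AE \<omega> in N. Y 0 \<omega> = x) \<and>
    (\<forall>n. \<forall>s\<ge>0. AE \<omega> in N.
      real_cond_exp N (history \<Omega> N Y S n n)
          (indicator {\<omega> \<in> space N. S n \<omega> < ennreal s}) \<omega>
        = 1 - exp (- integral {0..s} (\<lambda>w. lam (\<phi> (Y n \<omega>) w)))) \<and>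
    (\<forall>n. \<forall>B \<in> sets (restrict_space borel \<Omega>). AE \<omega> in N. S n \<omega> < \<top> \<longrightarrow>
      real_cond_exp N (history \<Omega> N Y S n (Suc n))
          (indicator {\<omega> \<in> space N. Y (Suc n) \<omega> \<in> B}) \<omega>
        = measure (Q (\<phi> (Y n \<omega>) (enn2real (S n \<omega>)))) B)"

text \<open>\<open>X\<close> is a non-explosive realisation, on the probability space \<open>N\<close>, of the
  process started at \<open>x\<close>.\<close>

definition pdmp_from ::
  "(real ^ 'n) set \<Rightarrow> (real ^ 'n \<Rightarrow> real) \<Rightarrow> (real ^ 'n \<Rightarrow> (real ^ 'n) measure)
    \<Rightarrow> (real ^ 'n \<Rightarrow> real \<Rightarrow> real ^ 'n) \<Rightarrow> real ^ 'n \<Rightarrow> 'w measure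
    \<Rightarrow> (real \<Rightarrow> 'w \<Rightarrow> real ^ 'n) \<Rightarrow> bool"
  where "pdmp_from \<Omega> lam Q \<phi> x N X \<longleftrightarrow>
    (\<forall>t\<ge>0. X t \<in> N \<rightarrow>\<^sub>M restrict_space borel \<Omega>) \<and>
    (\<exists>Y S. jump_chain \<Omega> lam Q \<phi> x N Y S \<and>
      (AE \<omega> in N. (\<lambda>n. jump_time S n \<omega>) \<longlonglongrightarrow> \<top>) \<and>
      (AE \<omega> in N. \<forall>n. \<forall>t\<ge>0.
        jump_time S n \<omega> \<le> ennreal t \<and> ennreal t < jump_time S (Suc n) \<omega> \<longrightarrow>
        X t \<omega> = \<phi> (Y n \<omega>) (t - enn2real (jump_time S n \<omega>))))"

definition kernel_op :: "('a \<Rightarrow> 'a measure) \<Rightarrow> ('a \<Rightarrow> real) \<Rightarrow> 'a \<Rightarrow> real"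
  where "kernel_op Q f x = (\<integral>y. f y \<partial>Q x)"

definition generator ::
  "(real ^ 'n \<Rightarrow> real ^ 'n) \<Rightarrow> (real ^ 'n \<Rightarrow> real) \<Rightarrow> (real ^ 'n \<Rightarrow> (real ^ 'n) measure)
    \<Rightarrow> (real ^ 'n \<Rightarrow> real) \<Rightarrow> real ^ 'n \<Rightarrow> real"
  where "generator b lam Q f x = b x \<bullet> grad f x + lam x * (kernel_op Q f x - f x)"

text \<open>In the next two definitions \<open>N x\<close> and \<open>X x\<close> carry the process started at \<open>x\<close>.\<close>

definition semigroup_op ::
  "('a \<Rightarrow> 'w measure) \<Rightarrow> ('a \<Rightarrow> real \<Rightarrow> 'w \<Rightarrow> 'a) \<Rightarrow> real \<Rightarrow> ('a \<Rightarrow> real) \<Rightarrow> 'a \<Rightarrow> real"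
  where "semigroup_op N X t f x = (\<integral>\<omega>. f (X x t \<omega>) \<partial>N x)"

definition invariant_law ::
  "(real ^ 'n) set \<Rightarrow> (real ^ 'n \<Rightarrow> 'w measure) \<Rightarrow> (real ^ 'n \<Rightarrow> real \<Rightarrow> 'w \<Rightarrow> real ^ 'n)
    \<Rightarrow> (real ^ 'n) measure \<Rightarrow> bool"
  where "invariant_law \<Omega> N X \<mu> \<longleftrightarrow>
    prob_space \<mu> \<and> sets \<mu> = sets (restrict_space borel \<Omega>) \<and>
    (\<forall>t\<ge>0. \<forall>B\<in>sets \<mu>.
      (\<integral>\<^sup>+x. emeasure (N x) {\<omega> \<in> space (N x). X x t \<omega> \<in> B} \<partial>\<mu>) = emeasure \<mu> B)"

section \<open>Standing assumptions\<close>

text \<open>Convergence to equilibrium: \<open>P\<^sub>t f (x)\<close> depends on the representative of a class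
  in \<open>L\<^sup>2(\<mu>)\<close>, so pointwise convergence is stated for the test functions, and for general
  square integrable \<open>f\<close> convergence is stated in \<open>L\<^sup>2(\<mu>)\<close>.

  Elementary calculus: \<open>backward\<close> and \<open>forward\<close> are the two Kolmogorov equations. By
  \<open>locally_bounded\<close>, the polynomial bounds on the derivatives of \<open>P\<^sub>t f\<close> are uniform for
  \<open>t\<close> in a compact interval; this domination is what makes differentiation under the
  integrals \<open>P\<^sub>t\<close> and \<open>\<mu>\<close> (and of \<open>\<nabla>P\<^sub>t f\<close> in \<open>t\<close>) licit.\<close>

locale pdmp_setting =
  fixes \<Omega> :: "(real ^ 'n) set"
    and b :: "real ^ 'n \<Rightarrow> real ^ 'n"
    and lam :: "real ^ 'n \<Rightarrow> real"
    and Q :: "real ^ 'n \<Rightarrow> (real ^ 'n) measure"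
    and \<phi> :: "real ^ 'n \<Rightarrow> real \<Rightarrow> real ^ 'n"
    and N :: "real ^ 'n \<Rightarrow> 'w measure"
    and X :: "real ^ 'n \<Rightarrow> real \<Rightarrow> 'w \<Rightarrow> real ^ 'n"
    and \<mu> :: "(real ^ 'n) measure"
  assumes open_domain: "open \<Omega>"
    and smooth_b: "\<And>k. smooth_on \<Omega> (\<lambda>x. b x $ k)"
    and smooth_rate: "smooth_on \<Omega> lam"
    and rate_nonneg: "\<And>x. x \<in> \<Omega> \<Longrightarrow> 0 \<le> lam x"
    and kernel: "Q \<in> restrict_space borel \<Omega> \<rightarrow>\<^sub>M prob_algebra (restrict_space borel \<Omega>)"
    and flow_0: "\<And>x. x \<in> \<Omega> \<Longrightarrow> \<phi> x 0 = x"
    and flow_in: "\<And>x t. x \<in> \<Omega> \<Longrightarrow> 0 \<le> t \<Longrightarrow> \<phi> x t \<in> \<Omega>"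
    and flow_deriv: "\<And>x t. x \<in> \<Omega> \<Longrightarrow> 0 \<le> t \<Longrightarrow>
      (\<phi> x has_vector_derivative b (\<phi> x t)) (at t within {0..})"
    and process: "\<And>x. x \<in> \<Omega> \<Longrightarrow> pdmp_from \<Omega> lam Q \<phi> x (N x) (X x)"
    and rate_pos_AE: "AE x in lborel. x \<in> \<Omega> \<longrightarrow> 0 < lam x"
    and rate_pos_fixed: "\<And>x. x \<in> \<Omega> \<Longrightarrow> \<forall>t\<ge>0. \<phi> x t = x \<Longrightarrow> 0 < lam x"
    and invariant: "invariant_law \<Omega> N X \<mu>"
    and invariant_unique: "\<And>\<nu>. invariant_law \<Omega> N X \<nu> \<Longrightarrow> \<nu> = \<mu>"
    and moments: "\<And>k::nat. integrable \<mu> (\<lambda>x. norm x ^ k)"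
    and convergence_pointwise: "\<And>f x. f \<in> test_functions \<Omega> \<Longrightarrow> x \<in> \<Omega> \<Longrightarrow>
      ((\<lambda>t. semigroup_op N X t f x) \<longlongrightarrow> (\<integral>y. f y \<partial>\<mu>)) at_top"
    and convergence_L2: "\<And>f. f \<in> borel_measurable \<mu> \<Longrightarrow> integrable \<mu> (\<lambda>x. (f x)\<^sup>2) \<Longrightarrow>
      ((\<lambda>t. \<integral>x. (semigroup_op N X t f x - (\<integral>y. f y \<partial>\<mu>))\<^sup>2 \<partial>\<mu>) \<longlongrightarrow> 0) at_top"
    and kernel_integrable: "\<And>f x. f \<in> test_functions \<Omega> \<Longrightarrow> x \<in> \<Omega> \<Longrightarrow> integrable (Q x) f"
    and semigroup_integrable: "\<And>f x t. f \<in> test_functions \<Omega> \<Longrightarrow> x \<in> \<Omega> \<Longrightarrow> 0 \<le> t \<Longrightarrow>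
      integrable (N x) (\<lambda>\<omega>. f (X x t \<omega>))"
    and kernel_stable: "\<And>f. f \<in> test_functions \<Omega> \<Longrightarrow> kernel_op Q f \<in> test_functions \<Omega>"
    and generator_stable: "\<And>f. f \<in> test_functions \<Omega> \<Longrightarrow>
      generator b lam Q f \<in> test_functions \<Omega>"
    and semigroup_stable: "\<And>f t. f \<in> test_functions \<Omega> \<Longrightarrow> 0 \<le> t \<Longrightarrow>
      semigroup_op N X t f \<in> test_functions \<Omega>"
    and backward: "\<And>f x t. f \<in> test_functions \<Omega> \<Longrightarrow> x \<in> \<Omega> \<Longrightarrow> 0 \<le> t \<Longrightarrow>
      ((\<lambda>s. semigroup_op N X s f x) has_real_derivative
        generator b lam Q (semigroup_op N X t f) x) (at t within {0..})"
    and forward: "\<And>f x t. f \<in> test_functions \<Omega> \<Longrightarrow> x \<in> \<Omega> \<Longrightarrow> 0 \<le> t \<Longrightarrow>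
      ((\<lambda>s. semigroup_op N X s f x) has_real_derivative
        semigroup_op N X t (generator b lam Q f) x) (at t within {0..})"
    and locally_bounded: "\<And>f is T. f \<in> test_functions \<Omega> \<Longrightarrow>
      \<exists>C k. \<forall>t\<in>{0..T}. \<forall>x\<in>\<Omega>. \<bar>partials is (semigroup_op N X t f) x\<bar> \<le> C * (1 + norm x) ^ k"

end

theory Submission
  imports Defs
begin

text \<open>
  Write \<open>h\<^sub>s = |\<nabla>P\<^sub>t\<^sub>-\<^sub>s f|\<^sup>2\<close>. The proof interpolates between the two sides: the function
  \<open>\<psi>(s) = e\<^sup>-\<^sup>\<eta>\<^sup>s P\<^sub>s h\<^sub>s (x)\<close> equals \<open>|\<nabla>P\<^sub>t f(x)|\<^sup>2\<close> at \<open>s = 0\<close> and the right hand side at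
  \<open>s = t\<close>, so it suffices that \<open>\<psi>\<close> is nondecreasing. With \<open>g = P\<^sub>t\<^sub>-\<^sub>s f\<close>, the Kolmogorov
  equations give \<open>d/ds P\<^sub>s h\<^sub>s = P\<^sub>s (L|\<nabla>g|\<^sup>2 - 2 \<nabla>g \<bullet> \<nabla>Lg)\<close> (\<open>interpolation_derivative\<close>), and
  since \<open>P\<^sub>s\<close> preserves inequalities the matter is reduced to the pointwise bound
  \<open>L|\<nabla>g|\<^sup>2 - 2 \<nabla>g \<bullet> \<nabla>Lg \<ge> \<eta> |\<nabla>g|\<^sup>2\<close> (\<open>dissipation_lower_bound\<close>).

  For a constant rate \<open>\<lambda>\<close> the left side can be computed exactly: the second derivatives of \<open>g\<close>
  cancel and \<open>\<lambda> (Q|\<nabla>g|\<^sup>2 + |\<nabla>g|\<^sup>2 - 2 \<nabla>g \<bullet> \<nabla>Qg) - 2 \<nabla>g \<bullet> J\<^sub>b \<nabla>g\<close> remains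
  (\<open>gradient_energy_commutator\<close>). The gradient bound on \<open>Q\<close> and Cauchy-Schwarz give
  \<open>2 \<nabla>g \<bullet> \<nabla>Qg \<le> M|\<nabla>g|\<^sup>2 + Q|\<nabla>g|\<^sup>2\<close>, after which the contraction hypothesis applies.

  The analytic work lies in differentiating \<open>P\<^sub>s h\<^sub>s\<close>, where \<open>s\<close> occurs twice. A single mean value
  estimate, \<open>partial_increment_bound\<close>, bounds the spatial gradient of a time increment by the
  gradient of the time derivative; it yields a first order Taylor expansion of \<open>\<nabla>P\<^sub>s f\<close> in \<open>s\<close>
  whose quadratic remainder is dominated by a test function (\<open>gradient_taylor\<close>) and hence stays
  quadratic after \<open>P\<^sub>s\<close> is applied. The same estimate proves the symmetry of second derivatives
  (\<open>mixed_partials_commute\<close>). All functions met on the way must be test functions for the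
  Kolmogorov equations to apply to them; hence the closure of the class under sums and products.
\<close>

section \<open>Partial derivatives\<close>

lemma partial_eq_derivative:
  assumes "(f has_derivative f') (at x)"
  shows "partial i f x = f' (axis i 1)"
  using frechet_derivative_at[OF assms] by (simp add: partial_def)

lemma has_derivative_grad:
  assumes "f differentiable (at x)"
  shows "(f has_derivative (\<lambda>h. grad f x \<bullet> h)) (at x)"
proof -
  let ?D = "frechet_derivative f (at x)"
  have D: "(f has_derivative ?D) (at x)"
    using assms by (simp add: frechet_derivative_works)
  then interpret linear ?D by (rule has_derivative_linear)
  have "?D h = grad f x \<bullet> h" for h
  proof -
    have "?D h = ?D (\<Sum>i\<in>UNIV. (h $ i) *\<^sub>R axis i 1)"
      using basis_expansion[of h] by (simp add: scalar_mult_eq_scaleR)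
    also have "\<dots> = grad f x \<bullet> h"
      by (simp add: sum scale grad_def partial_def inner_vec_def mult.commute)
    finally show ?thesis .
  qed
  then show ?thesis
    by (intro has_derivative_eq_rhs[OF D]) (simp add: fun_eq_iff)
qed

lemma partial_cong_open:
  assumes "f differentiable (at x)" "open G" "x \<in> G" "\<And>y. y \<in> G \<Longrightarrow> f y = g y"
  shows "partial i f x = partial i g x"
  unfolding partial_def using frechet_derivative_transform_within_open[OF assms] by simp

lemma differentiable_cong_open:
  assumes "f differentiable (at x)" "open G" "x \<in> G" "\<And>y. y \<in> G \<Longrightarrow> f y = g y"
  shows "g differentiable (at x)"
  using assms(1) has_derivative_transform_within_open[OF _ assms(2,3), of f _ UNIV g] assms(4)
  unfolding differentiable_def by blast

lemma partial_const: "partial i (\<lambda>y. c) x = 0"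
  by (rule partial_eq_derivative) (rule has_derivative_const)

lemma partial_coordinate: "partial i (\<lambda>y. y $ j) x = (if i = j then 1 else 0)"
proof -
  have "((\<lambda>y. y $ j) has_derivative (\<lambda>h. h $ j)) (at x)"
    by (rule bounded_linear.has_derivative[OF bounded_linear_vec_nth has_derivative_ident])
  then show ?thesis
    by (subst partial_eq_derivative, assumption) (auto simp: axis_def)
qed

lemma grad_inner_axis: "grad f x \<bullet> axis i 1 = partial i f x"
  by (simp add: inner_axis grad_def)

lemma partial_add:
  assumes "f differentiable (at x)" "g differentiable (at x)"
  shows "partial i (\<lambda>y. f y + g y) x = partial i f x + partial i g x"
  using partial_eq_derivative[OF has_derivative_add[OF assms[THEN has_derivative_grad]]]
  by (simp add: grad_inner_axis)

lemma partial_diff: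
  assumes "f differentiable (at x)" "g differentiable (at x)"
  shows "partial i (\<lambda>y. f y - g y) x = partial i f x - partial i g x"
  using partial_eq_derivative[OF has_derivative_diff[OF assms[THEN has_derivative_grad]]]
  by (simp add: grad_inner_axis)

lemma partial_mult:
  assumes "f differentiable (at x)" "g differentiable (at x)"
  shows "partial i (\<lambda>y. f y * g y) x = f x * partial i g x + partial i f x * g x"
  using partial_eq_derivative[OF has_derivative_mult[OF assms[THEN has_derivative_grad]]]
  by (simp add: grad_inner_axis)

lemma partial_cmult:
  assumes "f differentiable (at x)"
  shows "partial i (\<lambda>y. c * f y) x = c * partial i f x"
  using partial_mult[OF differentiable_const assms] by (simp add: partial_const)

lemma partial_sum:
  assumes "\<And>k. k \<in> I \<Longrightarrow> f k differentiable (at x)"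
  shows "partial i (\<lambda>y. \<Sum>k\<in>I. f k y) x = (\<Sum>k\<in>I. partial i (f k) x)"
  using partial_eq_derivative[OF has_derivative_sum[of I f "\<lambda>k h. grad (f k) x \<bullet> h"]] 
    has_derivative_grad[OF assms]
  by (simp add: grad_inner_axis)

lemma partial_translate:
  assumes "f differentiable (at (x + v))"
  shows "partial i (\<lambda>y. f (y + v)) x = partial i f (x + v)"
    and "(\<lambda>y. f (y + v)) differentiable (at x)"
proof -
  have "((\<lambda>y. f (y + v)) has_derivative (\<lambda>h. grad f (x + v) \<bullet> h)) (at x)"
    by (rule has_derivative_compose[where f = "\<lambda>y. y + v" and f' = "\<lambda>h. h" and g = f])
      (auto intro!: derivative_eq_intros has_derivative_grad assms)
  then show "(\<lambda>y. f (y + v)) differentiable (at x)"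
    and "partial i (\<lambda>y. f (y + v)) x = partial i f (x + v)"
    by (auto simp: differentiable_def partial_eq_derivative grad_inner_axis)
qed

lemma derivative_along_axis:
  assumes "f differentiable (at (x + h *\<^sub>R axis i 1))"
  shows "((\<lambda>h. f (x + h *\<^sub>R axis i 1)) has_real_derivative
    partial i f (x + h *\<^sub>R axis i 1)) (at h)"
proof -
  have "((\<lambda>h. f (x + h *\<^sub>R axis i 1)) has_derivative
      (\<lambda>k. grad f (x + h *\<^sub>R axis i 1) \<bullet> (k *\<^sub>R axis i 1))) (at h)"
    by (rule has_derivative_compose[where f = "\<lambda>h. x + h *\<^sub>R axis i 1" and g = f])
      (auto intro!: derivative_eq_intros has_derivative_grad assms)
  then show ?thesis
    unfolding has_field_derivative_def
    by (rule has_derivative_eq_rhs) (auto simp: inner_axis grad_def fun_eq_iff mult.commute)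
qed

text \<open>
  Exchanging a partial derivative with an increment in the parameter. The double difference of
  \<open>U\<close> in the parameter and along the \<open>i\<close>-th axis is estimated by the mean value theorem, first in
  the parameter and then in space, and then divided by the spatial step. The segment
  may run in either direction because time increments of both signs occur in \<open>gradient_taylor\<close>.
\<close>
lemma partial_increment_bound:
  fixes U V :: "real \<Rightarrow> real ^ 'n \<Rightarrow> real"
  assumes G: "open G" "x \<in> G"
    and dU: "\<And>r y. r \<in> closed_segment a c \<Longrightarrow> y \<in> G \<Longrightarrow>
      ((\<lambda>s. U s y) has_real_derivative V r y) (at r within closed_segment a c)"
    and U: "U a differentiable (at x)" "U c differentiable (at x)"
    and V: "\<And>r y. r \<in> closed_segment a c \<Longrightarrow> y \<in> G \<Longrightarrow> V r differentiable (at y)"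
    and K: "\<And>r y. r \<in> closed_segment a c \<Longrightarrow> y \<in> G \<Longrightarrow> \<bar>partial i (V r) y\<bar> \<le> K y"
    and cont: "isCont K x"
  shows "\<bar>partial i (U c) x - partial i (U a) x\<bar> \<le> \<bar>c - a\<bar> * K x"
proof (rule field_le_epsilon)
  fix e :: real assume e: "0 < e"
  define e' where "e' = e / (\<bar>c - a\<bar> + 1)"
  have e': "0 < e'" "\<bar>c - a\<bar> * e' \<le> e"
    using e by (auto simp: e'_def field_simps)
  let ?e = "axis i 1 :: real ^ 'n"
  have ev: "\<forall>\<^sub>F y in nhds x. y \<in> G \<and> K y < K x + e'"
  proof (rule eventually_conj)
    show "\<forall>\<^sub>F y in nhds x. y \<in> G"
      using G by (rule eventually_nhds_in_open)
    have "(K \<longlongrightarrow> K x) (nhds x)"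
      using cont by (simp add: isCont_def tendsto_at_iff_tendsto_nhds)
    then show "\<forall>\<^sub>F y in nhds x. K y < K x + e'"
      using e' by (intro order_tendstoD(2)) auto
  qed
  then obtain \<rho> where \<rho>: "0 < \<rho>" "\<And>y. dist y x < \<rho> \<Longrightarrow> y \<in> G \<and> K y < K x + e'"
    unfolding eventually_nhds_metric by blast
  have near: "x + h *\<^sub>R ?e \<in> G" "K (x + h *\<^sub>R ?e) \<le> K x + e'" if "0 \<le> h" "h < \<rho>" for h
    using \<rho>(2)[of "x + h *\<^sub>R ?e"] that by (auto simp: dist_norm)
  define W where "W h = U c (x + h *\<^sub>R ?e) - U a (x + h *\<^sub>R ?e)" for h
  let ?D = "partial i (U c) x - partial i (U a) x"
  have bound: "\<bar>W h - W 0\<bar> \<le> (h * (K x + e')) * \<bar>c - a\<bar>" if h: "0 < h" "h < \<rho>" for h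
  proof -
    \<comment> \<open>Mean value theorem in space for the derivative in the parameter; then in the parameter.\<close>
    have space: "\<bar>V r (x + h *\<^sub>R ?e) - V r x\<bar> \<le> h * (K x + e')"
      if r: "r \<in> closed_segment a c" for r
    proof -
      have "norm (V r (x + h *\<^sub>R ?e) - V r (x + 0 *\<^sub>R ?e)) \<le> (K x + e') * norm (h - 0)"
      proof (rule field_differentiable_bound[where S = "{0..h}" and x = h and y = 0
            and f = "\<lambda>k. V r (x + k *\<^sub>R ?e)"
            and f' = "\<lambda>k. partial i (V r) (x + k *\<^sub>R ?e)"])
        fix k assume k: "k \<in> {0..h}"
        show "((\<lambda>k. V r (x + k *\<^sub>R ?e)) has_real_derivative
            partial i (V r) (x + k *\<^sub>R ?e)) (at k within {0..h})"
          using near(1)[of k] k h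
          by (intro has_field_derivative_at_within[OF derivative_along_axis] V r) auto
        show "norm (partial i (V r) (x + k *\<^sub>R ?e)) \<le> K x + e'"
          using K[OF r near(1), of k] near(2)[of k] k h by auto
      qed (use h in auto)
      then show ?thesis using h by (simp add: mult.commute)
    qed
    have "norm ((U c (x + h *\<^sub>R ?e) - U c x) - (U a (x + h *\<^sub>R ?e) - U a x))
        \<le> (h * (K x + e')) * norm (c - a)"
    proof (rule field_differentiable_bound[where S = "closed_segment a c" and x = c and y = a
          and f = "\<lambda>r. U r (x + h *\<^sub>R ?e) - U r x"
          and f' = "\<lambda>r. V r (x + h *\<^sub>R ?e) - V r x"])
      fix r assume r: "r \<in> closed_segment a c"
      show "((\<lambda>r. U r (x + h *\<^sub>R ?e) - U r x) has_real_derivative V r (x + h *\<^sub>R ?e) - V r x)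
          (at r within closed_segment a c)"
        using near(1)[of h] h r G by (intro DERIV_diff dU) auto
      show "norm (V r (x + h *\<^sub>R ?e) - V r x) \<le> h * (K x + e')"
        using space[OF r] by simp
    qed auto
    then show ?thesis by (simp add: W_def algebra_simps)
  qed
  have "(W has_real_derivative ?D) (at 0)"
    unfolding W_def
    using derivative_along_axis[of "U c" x 0 i] derivative_along_axis[of "U a" x 0 i] U
    by (intro DERIV_diff) auto
  then have "((\<lambda>h. (W h - W 0) / (h - 0)) \<longlongrightarrow> ?D) (at_right 0)"
    unfolding has_field_derivative_iff by (rule filterlim_mono) (auto simp: at_within_le_at)
  then have lim: "((\<lambda>h. \<bar>(W h - W 0) / (h - 0)\<bar>) \<longlongrightarrow> \<bar>?D\<bar>) (at_right 0)"
    by (rule tendsto_rabs)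
  have "\<forall>\<^sub>F h in at_right 0. h < \<rho> \<and> 0 < h"
    using \<rho>(1) by (intro eventually_conj eventually_at_right_less order_tendstoD(2)[OF tendsto_ident_at])
  then have "\<forall>\<^sub>F h in at_right 0. \<bar>(W h - W 0) / (h - 0)\<bar> \<le> (K x + e') * \<bar>c - a\<bar>"
    by (rule eventually_mono) (use bound in \<open>auto simp: divide_simps abs_mult mult_ac\<close>)
  then have "\<bar>?D\<bar> \<le> (K x + e') * \<bar>c - a\<bar>"
    by (rule tendsto_upperbound[OF lim]) simp
  also have "\<dots> \<le> \<bar>c - a\<bar> * K x + e"
    using e'(2) by (simp add: algebra_simps)
  finally show "\<bar>?D\<bar> \<le> \<bar>c - a\<bar> * K x + e" .
qed

text \<open>
  Translation in the direction \<open>e\<^sub>j\<close> plays the role of time here: \<open>f (y + r e\<^sub>j)\<close> has the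
  \<open>r\<close>-derivative \<open>\<partial>\<^sub>j f (y + r e\<^sub>j)\<close>. After subtracting \<open>r \<partial>\<^sub>j f y\<close> the spatial gradient of this
  derivative is small near \<open>x\<close> by continuity of \<open>\<partial>\<^sub>i \<partial>\<^sub>j f\<close>, so \<open>partial_increment_bound\<close> says that
  \<open>\<partial>\<^sub>i f\<close> has the directional derivative \<open>\<partial>\<^sub>i \<partial>\<^sub>j f x\<close> along \<open>e\<^sub>j\<close>.
\<close>
lemma mixed_partials_commute:
  fixes f :: "real ^ 'n \<Rightarrow> real"
  assumes G: "open G" "x \<in> G"
    and f: "\<And>y. y \<in> G \<Longrightarrow> f differentiable (at y)"
    and fj: "\<And>y. y \<in> G \<Longrightarrow> partial j f differentiable (at y)"
    and fi: "partial i f differentiable (at x)"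
    and cont: "isCont (partial i (partial j f)) x"
  shows "partial j (partial i f) x = partial i (partial j f) x"
proof -
  let ?e = "axis j 1 :: real ^ 'n" and ?D = "partial i (partial j f) x"
  let ?q = "\<lambda>h. partial i f (x + h *\<^sub>R ?e)"
  have "(?q has_real_derivative ?D) (at 0)"
    unfolding has_field_derivative_iff
  proof (rule LIM_I)
    fix e :: real assume e: "0 < e"
    have "\<forall>\<^sub>F y in nhds x. y \<in> G \<and> dist (partial i (partial j f) y) ?D < e / 4"
    proof (rule eventually_conj)
      show "\<forall>\<^sub>F y in nhds x. y \<in> G"
        using G by (rule eventually_nhds_in_open)
      have "(partial i (partial j f) \<longlongrightarrow> ?D) (nhds x)"
        using cont by (simp add: isCont_def tendsto_at_iff_tendsto_nhds)
      then show "\<forall>\<^sub>F y in nhds x. dist (partial i (partial j f) y) ?D < e / 4"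
        using e by (intro tendstoD) auto
    qed
    then obtain \<rho> where \<rho>: "0 < \<rho>"
      "\<And>y. dist y x < \<rho> \<Longrightarrow> y \<in> G \<and> dist (partial i (partial j f) y) ?D < e / 4"
      unfolding eventually_nhds_metric by blast
    have near: "y + r *\<^sub>R ?e \<in> G"
      "\<bar>partial i (partial j f) (y + r *\<^sub>R ?e) - ?D\<bar> < e / 4"
      if "dist y x < \<rho> / 2" "\<bar>r\<bar> < \<rho> / 2" for y r
    proof -
      have "dist (y + r *\<^sub>R ?e) x \<le> dist y x + \<bar>r\<bar>"
        using norm_triangle_ineq[of "y - x" "r *\<^sub>R ?e"] by (simp add: dist_norm algebra_simps)
      also have "\<dots> < \<rho>" using that by simp
      finally show "y + r *\<^sub>R ?e \<in> G"
        "\<bar>partial i (partial j f) (y + r *\<^sub>R ?e) - ?D\<bar> < e / 4"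
        using \<rho>(2) by (auto simp: dist_real_def)
    qed
    have main: "\<bar>?q h - ?q 0 - h * ?D\<bar> \<le> \<bar>h\<bar> * (e / 2)" if h: "\<bar>h\<bar> < \<rho> / 2" for h
    proof -
      define U where "U r y = f (y + r *\<^sub>R ?e) - r * partial j f y" for r y
      define V where "V r y = partial j f (y + r *\<^sub>R ?e) - partial j f y" for r y
      have small: "\<bar>r\<bar> < \<rho> / 2" if "r \<in> closed_segment 0 h" for r
        using that h by (auto simp: closed_segment_eq_real_ivl split: if_splits)
      have y0: "y \<in> G" if "y \<in> ball x (\<rho> / 2)" for y
        using near(1)[of y 0] that \<rho>(1) by (simp add: dist_commute abs_if split: if_splits)
      have U_diff: "U r differentiable (at x)" if "\<bar>r\<bar> < \<rho> / 2" for r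
        unfolding U_def using near(1)[of x r] that \<rho>(1) G
        by (intro differentiable_diff differentiable_mult differentiable_const fj
            partial_translate(2) f) auto
      have "\<bar>partial i (U h) x - partial i (U 0) x\<bar> \<le> \<bar>h - 0\<bar> * (e / 2)"
      proof (rule partial_increment_bound[where G = "ball x (\<rho> / 2)" and V = V and K = "\<lambda>_. e / 2"])
        fix r y assume r: "r \<in> closed_segment 0 h" and y: "y \<in> ball x (\<rho> / 2)"
        have yr: "y + r *\<^sub>R ?e \<in> G" and b: "\<bar>partial i (partial j f) (y + r *\<^sub>R ?e) - ?D\<bar> < e / 4"
          using near[of y r] small[OF r] y by (auto simp: dist_commute)
        show "((\<lambda>s. U s y) has_real_derivative V r y) (at r within closed_segment 0 h)"
          unfolding U_def V_def
          by (intro DERIV_diff has_field_derivative_at_within[OF derivative_along_axis] f yr)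
            (auto intro!: derivative_eq_intros)
        show "V r differentiable (at y)"
          unfolding V_def using yr y0[OF y]
          by (intro differentiable_diff fj partial_translate(2)) auto
        have "partial i (V r) y = partial i (partial j f) (y + r *\<^sub>R ?e) - partial i (partial j f) y"
          unfolding V_def using fj[OF yr] fj[OF y0[OF y]]
          by (subst partial_diff) (auto simp: partial_translate)
        then show "\<bar>partial i (V r) y\<bar> \<le> e / 2"
          using b near(2)[of y 0] y \<rho>(1) by (simp add: dist_commute abs_if split: if_splits)
      qed (use \<rho>(1) U_diff[of 0] U_diff[OF h] in auto)
      moreover have "partial i (U r) x = ?q r - r * ?D" if "\<bar>r\<bar> < \<rho> / 2" for r
      proof -
        have "f differentiable (at (x + r *\<^sub>R ?e))"
          using near(1)[of x r] that \<rho>(1) by (intro f) auto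
        then show ?thesis
          unfolding U_def using fj[OF G(2)]
          by (subst partial_diff)
            (auto simp: partial_translate partial_cmult
              intro!: differentiable_mult differentiable_const)
      qed
      ultimately show ?thesis using h \<rho>(1) by (simp add: algebra_simps)
    qed
    show "\<exists>d>0. \<forall>h. h \<noteq> 0 \<and> norm (h - 0) < d \<longrightarrow> norm ((?q h - ?q 0) / (h - 0) - ?D) < e"
    proof (intro exI[of _ "\<rho> / 2"] conjI allI impI)
      fix h :: real assume h: "h \<noteq> 0 \<and> norm (h - 0) < \<rho> / 2"
      have "(?q h - ?q 0) / (h - 0) - ?D = (?q h - ?q 0 - h * ?D) / h"
        using h by (simp add: field_simps)
      also have "norm \<dots> \<le> e / 2"
        using main[of h] h by (simp add: divide_simps mult.commute)
      also have "\<dots> < e" using e by simp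
      finally show "norm ((?q h - ?q 0) / (h - 0) - ?D) < e" .
    qed (use \<rho>(1) in simp)
  qed
  moreover have "(?q has_real_derivative partial j (partial i f) x) (at 0)"
    using derivative_along_axis[of "partial i f" x 0 j] fi by simp
  ultimately show ?thesis by (rule DERIV_unique[THEN sym])
qed

section \<open>The algebra of test functions\<close>

lemma partials_Nil: "partials [] f = f"
  by (simp add: partials_def)

lemma partials_Cons: "partials (i # is) f = partial i (partials is f)"
  by (simp add: partials_def)

lemma partials_partial: "partials is (partial i f) = partials (is @ [i]) f"
  by (simp add: partials_def)

lemma test_functions_partial:
  assumes "f \<in> test_functions \<Omega>"
  shows "partial i f \<in> test_functions \<Omega>"
  using assms unfolding test_functions_def smooth_on_def by (auto simp: partials_partial)

lemma test_functions_differentiable: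
  assumes "f \<in> test_functions \<Omega>" "x \<in> \<Omega>"
  shows "f differentiable (at x)"
proof -
  have "partials [] f differentiable (at x)"
    using assms unfolding test_functions_def smooth_on_def by blast
  then show ?thesis by (simp add: partials_Nil)
qed

definition poly_bounded_on :: "(real ^ 'n) set \<Rightarrow> (real ^ 'n \<Rightarrow> real) \<Rightarrow> bool"
  where "poly_bounded_on \<Omega> f \<longleftrightarrow> (\<exists>C k. \<forall>x\<in>\<Omega>. \<bar>f x\<bar> \<le> C * (1 + norm x) ^ k)"

lemma test_functions_poly_bounded:
  assumes "f \<in> test_functions \<Omega>"
  shows "poly_bounded_on \<Omega> f"
proof -
  have "\<exists>C k. \<forall>x\<in>\<Omega>. \<bar>partials [] f x\<bar> \<le> C * (1 + norm x) ^ k"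
    using assms unfolding test_functions_def by blast
  then show ?thesis by (simp add: partials_Nil poly_bounded_on_def)
qed

lemma poly_bounded_onE:
  assumes "poly_bounded_on \<Omega> f"
  obtains C k where "0 \<le> C" "\<And>x. x \<in> \<Omega> \<Longrightarrow> \<bar>f x\<bar> \<le> C * (1 + norm x) ^ k"
proof -
  from assms obtain C k where C: "\<And>x. x \<in> \<Omega> \<Longrightarrow> \<bar>f x\<bar> \<le> C * (1 + norm x) ^ k"
    unfolding poly_bounded_on_def by blast
  have "C * (1 + norm x) ^ k \<le> \<bar>C\<bar> * (1 + norm x) ^ k" for x :: "real ^ 'a"
    by (intro mult_right_mono) auto
  with C show ?thesis
    by (intro that[of "\<bar>C\<bar>" k]) (simp, rule order_trans)
qed

lemma poly_bounded_on_add: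
  assumes "poly_bounded_on \<Omega> f" "poly_bounded_on \<Omega> g"
  shows "poly_bounded_on \<Omega> (\<lambda>x. f x + g x)"
proof -
  obtain C k where C: "0 \<le> C" "\<And>x. x \<in> \<Omega> \<Longrightarrow> \<bar>f x\<bar> \<le> C * (1 + norm x) ^ k"
    using poly_bounded_onE[OF assms(1)] by blast
  obtain D l where D: "0 \<le> D" "\<And>x. x \<in> \<Omega> \<Longrightarrow> \<bar>g x\<bar> \<le> D * (1 + norm x) ^ l"
    using poly_bounded_onE[OF assms(2)] by blast
  have "\<bar>f x + g x\<bar> \<le> (C + D) * (1 + norm x) ^ (k + l)" if "x \<in> \<Omega>" for x
  proof -
    have "\<bar>f x + g x\<bar> \<le> C * (1 + norm x) ^ k + D * (1 + norm x) ^ l"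
      using C(2)[OF that] D(2)[OF that] by linarith
    also have "\<dots> \<le> C * (1 + norm x) ^ (k + l) + D * (1 + norm x) ^ (k + l)"
      using C(1) D(1) by (intro add_mono mult_left_mono power_increasing) auto
    finally show ?thesis by (simp add: algebra_simps)
  qed
  then show ?thesis unfolding poly_bounded_on_def by blast
qed

lemma poly_bounded_on_mult:
  assumes "poly_bounded_on \<Omega> f" "poly_bounded_on \<Omega> g"
  shows "poly_bounded_on \<Omega> (\<lambda>x. f x * g x)"
proof -
  obtain C k where C: "0 \<le> C" "\<And>x. x \<in> \<Omega> \<Longrightarrow> \<bar>f x\<bar> \<le> C * (1 + norm x) ^ k"
    using poly_bounded_onE[OF assms(1)] by blast
  obtain D l where D: "0 \<le> D" "\<And>x. x \<in> \<Omega> \<Longrightarrow> \<bar>g x\<bar> \<le> D * (1 + norm x) ^ l"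
    using poly_bounded_onE[OF assms(2)] by blast
  have "\<bar>f x * g x\<bar> \<le> (C * D) * (1 + norm x) ^ (k + l)" if "x \<in> \<Omega>" for x
  proof -
    have "\<bar>f x\<bar> * \<bar>g x\<bar> \<le> (C * (1 + norm x) ^ k) * (D * (1 + norm x) ^ l)"
      using C D that by (intro mult_mono) auto
    then show ?thesis by (simp add: abs_mult power_add mult_ac)
  qed
  then show ?thesis unfolding poly_bounded_on_def by blast
qed

text \<open>
  Membership of a product in the class would ordinarily require the Leibniz formula for all
  multi-indices. This principle avoids it: it is enough to exhibit a set of functions that are
  differentiable, polynomially bounded, and whose first partial derivatives lie in the same set.
  Agreement on \<open>\<Omega>\<close> suffices because the rules for derivatives are only available there.
\<close>
lemma test_functions_coinduct:
  assumes \<Omega>: "open \<Omega>" and f: "f \<in> S"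
    and step: "\<And>f. f \<in> S \<Longrightarrow> (\<forall>x\<in>\<Omega>. f differentiable (at x)) \<and> poly_bounded_on \<Omega> f \<and>
      (\<forall>i. \<exists>g\<in>S. \<forall>x\<in>\<Omega>. partial i f x = g x)"
  shows "f \<in> test_functions \<Omega>"
proof -
  have rep: "\<exists>g\<in>S. \<forall>x\<in>\<Omega>. partials is f x = g x" for "is"
  proof (induction "is")
    case Nil
    then show ?case using f by (auto simp: partials_Nil)
  next
    case (Cons i js)
    then obtain g where g: "g \<in> S" "\<And>x. x \<in> \<Omega> \<Longrightarrow> partials js f x = g x" by blast
    obtain g' where g': "g' \<in> S" "\<And>x. x \<in> \<Omega> \<Longrightarrow> partial i g x = g' x"
      using step[OF g(1)] by blast
    have "partials (i # js) f x = g' x" if x: "x \<in> \<Omega>" for x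
      using partial_cong_open[of g x \<Omega> "partials js f" i] step[OF g(1)] \<Omega> x g(2) g'(2)
      by (simp add: partials_Cons)
    with g'(1) show ?case by blast
  qed
  have "partials is f differentiable (at x)" if x: "x \<in> \<Omega>" for "is" x
  proof -
    obtain g where g: "g \<in> S" "\<And>y. y \<in> \<Omega> \<Longrightarrow> partials is f y = g y" using rep by blast
    then show ?thesis
      using differentiable_cong_open[of g x \<Omega> "partials is f"] step[OF g(1)] \<Omega> x by simp
  qed
  moreover have "\<exists>C k. \<forall>x\<in>\<Omega>. \<bar>partials is f x\<bar> \<le> C * (1 + norm x) ^ k" for "is"
  proof -
    obtain g where g: "g \<in> S" "\<And>y. y \<in> \<Omega> \<Longrightarrow> partials is f y = g y" using rep by blast
    from step[OF g(1)] obtain C k where "\<And>y. y \<in> \<Omega> \<Longrightarrow> \<bar>g y\<bar> \<le> C * (1 + norm y) ^ k"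
      unfolding poly_bounded_on_def by blast
    then show ?thesis by (intro exI[of _ C] exI[of _ k]) (simp add: g(2))
  qed
  ultimately show ?thesis by (simp add: test_functions_def smooth_on_def)
qed

text \<open>
  The smallest set containing the constants, the coordinates and the test functions and closed
  under sums and products. It is a device for \<open>test_functions_coinduct\<close>: unlike the set of
  products of two test functions, it is stable under differentiation.
\<close>
inductive_set test_algebra :: "(real ^ 'n) set \<Rightarrow> (real ^ 'n \<Rightarrow> real) set" for \<Omega>
  where base: "f \<in> test_functions \<Omega> \<Longrightarrow> f \<in> test_algebra \<Omega>"
  | const: "(\<lambda>x. c) \<in> test_algebra \<Omega>"
  | coordinate: "(\<lambda>x. x $ j) \<in> test_algebra \<Omega>"
  | add: "f \<in> test_algebra \<Omega> \<Longrightarrow> g \<in> test_algebra \<Omega> \<Longrightarrow> (\<lambda>x. f x + g x) \<in> test_algebra \<Omega>"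
  | mult: "f \<in> test_algebra \<Omega> \<Longrightarrow> g \<in> test_algebra \<Omega> \<Longrightarrow> (\<lambda>x. f x * g x) \<in> test_algebra \<Omega>"

lemma test_algebra_step:
  assumes "f \<in> test_algebra \<Omega>"
  shows "(\<forall>x\<in>\<Omega>. f differentiable (at x)) \<and> poly_bounded_on \<Omega> f \<and>
      (\<forall>i. \<exists>g\<in>test_algebra \<Omega>. \<forall>x\<in>\<Omega>. partial i f x = g x)"
  using assms
proof induction
  case (base f)
  then show ?case
    using test_functions_differentiable test_functions_poly_bounded test_functions_partial
      test_algebra.base by blast
next
  case (const c)
  have "poly_bounded_on \<Omega> (\<lambda>x. c)"
    unfolding poly_bounded_on_def by (intro exI[of _ "\<bar>c\<bar>"] exI[of _ 0]) simp
  then show ?case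
    by (intro conjI allI ballI bexI[OF _ test_algebra.const[of 0]]) (simp_all add: partial_const)
next
  case (coordinate j)
  have "\<bar>x $ j\<bar> \<le> 1 * (1 + norm x) ^ 1" for x :: "real ^ 'a"
    using component_le_norm_cart[of x j] by simp
  then have "poly_bounded_on \<Omega> (\<lambda>x. x $ j)"
    unfolding poly_bounded_on_def by blast
  moreover have "(\<lambda>x. x $ j) differentiable (at x)" for x :: "real ^ 'a"
    by (simp add: bounded_linear_imp_differentiable bounded_linear_vec_nth)
  moreover have "\<exists>g\<in>test_algebra \<Omega>. \<forall>x\<in>\<Omega>. partial i (\<lambda>x. x $ j) x = g x" for i
    by (intro bexI[OF _ test_algebra.const[of "if i = j then 1 else 0"]]) (simp add: partial_coordinate)
  ultimately show ?case by blast
next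
  case (add f g)
  have "\<exists>h\<in>test_algebra \<Omega>. \<forall>x\<in>\<Omega>. partial i (\<lambda>x. f x + g x) x = h x" for i
  proof -
    obtain f' where f': "f' \<in> test_algebra \<Omega>" "\<And>x. x \<in> \<Omega> \<Longrightarrow> partial i f x = f' x"
      using add.IH by blast
    obtain g' where g': "g' \<in> test_algebra \<Omega>" "\<And>x. x \<in> \<Omega> \<Longrightarrow> partial i g x = g' x"
      using add.IH by blast
    show ?thesis
      using add.IH f' g' by (intro bexI[OF _ test_algebra.add[OF f'(1) g'(1)]]) (simp add: partial_add)
  qed
  then show ?case
    using add.IH by (simp add: poly_bounded_on_add differentiable_add)
next
  case (mult f g)
  have "\<exists>h\<in>test_algebra \<Omega>. \<forall>x\<in>\<Omega>. partial i (\<lambda>x. f x * g x) x = h x" for i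
  proof -
    obtain f' where f': "f' \<in> test_algebra \<Omega>" "\<And>x. x \<in> \<Omega> \<Longrightarrow> partial i f x = f' x"
      using mult.IH by blast
    obtain g' where g': "g' \<in> test_algebra \<Omega>" "\<And>x. x \<in> \<Omega> \<Longrightarrow> partial i g x = g' x"
      using mult.IH by blast
    have "(\<lambda>x. f x * g' x + f' x * g x) \<in> test_algebra \<Omega>"
      using mult.hyps f'(1) g'(1) by (intro test_algebra.add test_algebra.mult)
    then show ?thesis
      using mult.IH f' g' by (intro bexI) (auto simp: partial_mult)
  qed
  then show ?case
    using mult.IH by (simp add: poly_bounded_on_mult differentiable_mult)
qed

lemma test_algebra_subset:
  assumes "open \<Omega>"
  shows "test_algebra \<Omega> \<subseteq> test_functions \<Omega>"
  by (rule subsetI, rule test_functions_coinduct[OF assms, where S = "test_algebra \<Omega>"])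
    (simp, rule test_algebra_step)

lemma test_functions_const:
  assumes "open \<Omega>"
  shows "(\<lambda>x. c) \<in> test_functions \<Omega>"
  by (rule subsetD[OF test_algebra_subset[OF assms] test_algebra.const])

lemma test_functions_coordinate:
  assumes "open \<Omega>"
  shows "(\<lambda>x. x $ j) \<in> test_functions \<Omega>"
  by (rule subsetD[OF test_algebra_subset[OF assms] test_algebra.coordinate])

lemma test_functions_add:
  assumes "open \<Omega>" "f \<in> test_functions \<Omega>" "g \<in> test_functions \<Omega>"
  shows "(\<lambda>x. f x + g x) \<in> test_functions \<Omega>"
  by (rule subsetD[OF test_algebra_subset[OF assms(1)] test_algebra.add])
    (rule test_algebra.base assms(2,3))+

lemma test_functions_mult:
  assumes "open \<Omega>" "f \<in> test_functions \<Omega>" "g \<in> test_functions \<Omega>"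
  shows "(\<lambda>x. f x * g x) \<in> test_functions \<Omega>"
  by (rule subsetD[OF test_algebra_subset[OF assms(1)] test_algebra.mult])
    (rule test_algebra.base assms(2,3))+

lemma test_functions_cmult:
  assumes "open \<Omega>" "f \<in> test_functions \<Omega>"
  shows "(\<lambda>x. c * f x) \<in> test_functions \<Omega>"
  by (intro test_functions_mult test_functions_const assms)

lemma test_functions_sum:
  assumes "open \<Omega>" "\<And>i. i \<in> I \<Longrightarrow> f i \<in> test_functions \<Omega>"
  shows "(\<lambda>x. \<Sum>i\<in>I. f i x) \<in> test_functions \<Omega>"
  using assms(2)
  by (induction I rule: infinite_finite_induct)
    (auto intro: test_functions_const test_functions_add assms(1))

lemma test_functions_power:
  assumes "open \<Omega>" "f \<in> test_functions \<Omega>"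
  shows "(\<lambda>x. f x ^ k) \<in> test_functions \<Omega>"
  by (induction k) (auto intro: test_functions_const test_functions_mult assms)

text \<open>
  The functions \<open>(1 + |x|)\<^sup>k\<close> bounding test functions are not smooth at the origin. A smooth majorant
  makes the bound itself a test function, to which the semigroup can be applied.
\<close>
lemma polynomial_majorant:
  assumes "open \<Omega>" "0 \<le> C"
  obtains W where "W \<in> test_functions \<Omega>" "\<And>x. C * (1 + norm x) ^ k \<le> W x"
proof
  let ?W = "\<lambda>x :: real ^ 'a. C * (2 * (1 + (\<Sum>i\<in>UNIV. x $ i ^ 2))) ^ k"
  show "?W \<in> test_functions \<Omega>"
    by (intro test_functions_cmult test_functions_power test_functions_add test_functions_const
        test_functions_sum test_functions_coordinate assms(1))
  fix x :: "real ^ 'a"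
  have "(\<Sum>i\<in>UNIV. x $ i ^ 2) = (norm x)\<^sup>2"
    by (simp add: norm_vec_def L2_set_def sum_nonneg)
  moreover have "1 + norm x \<le> 2 * (1 + (norm x)\<^sup>2)"
  proof -
    \<comment> \<open>This is \<open>0 \<le> (|x| - 1)\<^sup>2\<close>.\<close>
    have "2 * norm x \<le> 1 + (norm x)\<^sup>2"
      using zero_le_power2[of "norm x - 1"] by (simp add: power2_eq_square algebra_simps)
    with zero_le_power2[of "norm x"] norm_ge_zero[of x] show ?thesis
      by argo
  qed
  ultimately show "C * (1 + norm x) ^ k \<le> ?W x"
    using assms(2) by (intro mult_left_mono power_mono) auto
qed

section \<open>The semigroup on test functions\<close>

lemma norm_grad_squared: "(norm (grad f y))\<^sup>2 = (\<Sum>i\<in>UNIV. (partial i f y)\<^sup>2)"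
  by (simp add: norm_vec_def L2_set_def sum_nonneg grad_def)

lemma norm_grad_squared_test_function:
  assumes "open \<Omega>" "f \<in> test_functions \<Omega>"
  shows "(\<lambda>y. (norm (grad f y))\<^sup>2) \<in> test_functions \<Omega>"
  unfolding norm_grad_squared
  by (intro test_functions_sum test_functions_power test_functions_partial assms)

context pdmp_setting
begin

abbreviation "\<A> \<equiv> test_functions \<Omega>"
abbreviation "P \<equiv> semigroup_op N X"
abbreviation "L \<equiv> generator b lam Q"

lemmas closed_under = test_functions_const[OF open_domain] test_functions_add[OF open_domain]
  test_functions_mult[OF open_domain] test_functions_cmult[OF open_domain]
  test_functions_sum[OF open_domain] test_functions_power[OF open_domain]

lemma process_in_domain:
  assumes "x \<in> \<Omega>" "0 \<le> t" "\<omega> \<in> space (N x)"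
  shows "X x t \<omega> \<in> \<Omega>"
proof -
  have "X x t \<in> N x \<rightarrow>\<^sub>M restrict_space borel \<Omega>"
    using process[OF assms(1)] assms(2) unfolding pdmp_from_def by blast
  from measurable_space[OF this assms(3)] show ?thesis by (simp add: space_restrict_space)
qed

lemma P_cong:
  assumes "x \<in> \<Omega>" "0 \<le> t" "\<And>y. y \<in> \<Omega> \<Longrightarrow> f y = g y"
  shows "P t f x = P t g x"
  unfolding semigroup_op_def
  by (rule Bochner_Integration.integral_cong) (auto intro: assms process_in_domain)

lemma P_mono:
  assumes "x \<in> \<Omega>" "0 \<le> t" "f \<in> \<A>" "g \<in> \<A>" "\<And>y. y \<in> \<Omega> \<Longrightarrow> f y \<le> g y"
  shows "P t f x \<le> P t g x"
  unfolding semigroup_op_def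
  by (rule integral_mono) (auto intro: assms semigroup_integrable process_in_domain)

lemma P_add:
  assumes "x \<in> \<Omega>" "0 \<le> t" "f \<in> \<A>" "g \<in> \<A>"
  shows "P t (\<lambda>y. f y + g y) x = P t f x + P t g x"
  unfolding semigroup_op_def
  by (rule Bochner_Integration.integral_add) (auto intro: assms semigroup_integrable)

lemma P_cmult: "P t (\<lambda>y. c * f y) x = c * P t f x"
  unfolding semigroup_op_def by simp

lemma P_abs_le:
  assumes "x \<in> \<Omega>" "0 \<le> t" "f \<in> \<A>" "g \<in> \<A>" "\<And>y. y \<in> \<Omega> \<Longrightarrow> \<bar>f y\<bar> \<le> g y"
  shows "\<bar>P t f x\<bar> \<le> P t g x"
proof -
  have "P t f x \<le> P t g x"
    using assms(5) by (intro P_mono assms) (meson abs_le_D1)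
  moreover have "P t (\<lambda>y. (- 1) * f y) x \<le> P t g x"
    using assms(5) by (intro P_mono closed_under assms) (auto dest: abs_le_D2)
  ultimately show ?thesis unfolding P_cmult by simp
qed

lemma P_bounded:
  assumes "f \<in> \<A>" "x \<in> \<Omega>"
  obtains B where "\<And>t. t \<in> {0..T} \<Longrightarrow> \<bar>P t f x\<bar> \<le> B"
proof -
  obtain C k where "\<forall>t\<in>{0..T}. \<forall>y\<in>\<Omega>. \<bar>partials [] (P t f) y\<bar> \<le> C * (1 + norm y) ^ k"
    using locally_bounded[OF assms(1)] by blast
  then show ?thesis
    using assms(2) by (intro that[of "C * (1 + norm x) ^ k"]) (simp add: partials_Nil)
qed

text \<open>The two Kolmogorov equations compute the same one-sided time derivative.\<close>
lemma generator_P_commute: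
  assumes "f \<in> \<A>" "x \<in> \<Omega>" "0 \<le> t"
  shows "L (P t f) x = P t (L f) x"
proof (rule has_field_derivative_unique[OF backward[OF assms] forward[OF assms]])
  have "at_right t \<le> at t within {0..}"
    using assms(3) by (intro at_le) auto
  then show "at t within {0..} \<noteq> bot"
    using trivial_limit_at_right_real[of t] by (auto simp: bot_unique)
qed

lemma gradient_majorant:
  assumes "f \<in> \<A>"
  obtains W where "W \<in> \<A>" "\<And>y. 0 \<le> W y"
    "\<And>i t y. t \<in> {0..T} \<Longrightarrow> y \<in> \<Omega> \<Longrightarrow> \<bar>partial i (P t f) y\<bar> \<le> W y"
proof -
  have "\<exists>W\<in>\<A>. (\<forall>y. 0 \<le> W y) \<and> (\<forall>t\<in>{0..T}. \<forall>y\<in>\<Omega>. \<bar>partial i (P t f) y\<bar> \<le> W y)" for i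
  proof -
    obtain C k where C: "\<forall>t\<in>{0..T}. \<forall>y\<in>\<Omega>. \<bar>partials [i] (P t f) y\<bar> \<le> C * (1 + norm y) ^ k"
      using locally_bounded[OF assms] by blast
    obtain W where W: "W \<in> \<A>" "\<And>y. \<bar>C\<bar> * (1 + norm y) ^ k \<le> W y"
      using polynomial_majorant[OF open_domain, of "\<bar>C\<bar>" k] by auto
    have "0 \<le> W y" for y
      by (rule order_trans[OF _ W(2)]) simp
    moreover have "\<bar>partial i (P t f) y\<bar> \<le> W y" if t: "t \<in> {0..T}" and y: "y \<in> \<Omega>" for t y
    proof -
      have "\<bar>partial i (P t f) y\<bar> \<le> C * (1 + norm y) ^ k"
        using C t y by (simp add: partials_Cons partials_Nil)
      also have "\<dots> \<le> \<bar>C\<bar> * (1 + norm y) ^ k"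
        by (intro mult_right_mono) auto
      finally show ?thesis using W(2)[of y] by linarith
    qed
    ultimately show ?thesis using W(1) by blast
  qed
  then obtain W where W: "\<And>i. W i \<in> \<A>" "\<And>i y. 0 \<le> W i y"
    "\<And>i t y. t \<in> {0..T} \<Longrightarrow> y \<in> \<Omega> \<Longrightarrow> \<bar>partial i (P t f) y\<bar> \<le> W i y"
    by metis
  show ?thesis
  proof (rule that[of "\<lambda>y. \<Sum>i\<in>UNIV. W i y"])
    show "(\<lambda>y. \<Sum>i\<in>UNIV. W i y) \<in> \<A>" by (intro closed_under W)
    show "0 \<le> (\<Sum>i\<in>UNIV. W i y)" for y by (intro sum_nonneg W)
    show "\<bar>partial i (P t f) y\<bar> \<le> (\<Sum>i\<in>UNIV. W i y)" if "t \<in> {0..T}" "y \<in> \<Omega>" for i t y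
      using W(3)[OF that, of i] member_le_sum[of i UNIV "\<lambda>i. W i y"] W(2) by fastforce
  qed
qed

text \<open>
  Since \<open>\<partial>\<^sub>r P\<^sub>r f = P\<^sub>r L f\<close>, the time increments of \<open>\<nabla>P\<^sub>r f\<close> are controlled by \<open>\<nabla>P\<^sub>r L f\<close>.
\<close>
lemma gradient_increment:
  assumes f: "f \<in> \<A>" and st: "s \<in> {0..T}" "t \<in> {0..T}" and y: "y \<in> \<Omega>"
    and W: "isCont W y" "\<And>r z. r \<in> {0..T} \<Longrightarrow> z \<in> \<Omega> \<Longrightarrow> \<bar>partial i (P r (L f)) z\<bar> \<le> W z"
  shows "\<bar>partial i (P t f) y - partial i (P s f) y\<bar> \<le> \<bar>t - s\<bar> * W y"
proof (rule partial_increment_bound[where G = \<Omega> and U = "\<lambda>r. P r f" and V = "\<lambda>r. P r (L f)"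
      and K = W])
  have seg: "closed_segment s t \<subseteq> {0..T}"
    using st by (auto simp: closed_segment_eq_real_ivl split: if_splits)
  fix r z assume r: "r \<in> closed_segment s t" and z: "z \<in> \<Omega>"
  show "((\<lambda>q. P q f z) has_real_derivative P r (L f) z) (at r within closed_segment s t)"
    using seg r by (intro has_field_derivative_subset[OF forward[OF f z]]) auto
  show "P r (L f) differentiable (at z)"
    using seg r by (intro test_functions_differentiable[OF semigroup_stable[OF generator_stable[OF f]] z]) auto
  show "\<bar>partial i (P r (L f)) z\<bar> \<le> W z"
    using seg r z by (intro W) auto
qed (use st y W open_domain in \<open>auto intro!: test_functions_differentiable semigroup_stable f\<close>)

text \<open>
  The first order time expansion of \<open>\<nabla>P\<^sub>r f\<close>. Subtracting the linear part \<open>r P\<^sub>s L f\<close> leaves the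
  time derivative \<open>P\<^sub>r L f - P\<^sub>s L f\<close>, whose gradient is itself of order \<open>|t - s|\<close> by
  \<open>gradient_increment\<close> applied to \<open>L f\<close>; this is why a bound on \<open>\<nabla>P\<^sub>r L\<^sup>2 f\<close> appears.
\<close>
lemma gradient_taylor:
  assumes f: "f \<in> \<A>" and st: "s \<in> {0..T}" "t \<in> {0..T}" and y: "y \<in> \<Omega>"
    and W: "W \<in> \<A>" "\<And>r z. r \<in> {0..T} \<Longrightarrow> z \<in> \<Omega> \<Longrightarrow> \<bar>partial i (P r (L (L f))) z\<bar> \<le> W z"
  shows "\<bar>partial i (P t f) y - partial i (P s f) y - (t - s) * partial i (P s (L f)) y\<bar>
    \<le> (t - s)\<^sup>2 * W y"
proof -
  define U where "U r z = P r f z - r * P s (L f) z" for r z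
  define V where "V r z = P r (L f) z - P s (L f) z" for r z
  have seg: "closed_segment s t \<subseteq> {0..T}"
    using st by (auto simp: closed_segment_eq_real_ivl split: if_splits)
  have d: "P r f differentiable (at z)" "P r (L f) differentiable (at z)"
    if "r \<in> {0..T}" "z \<in> \<Omega>" for r z
    using that by (auto intro!: test_functions_differentiable semigroup_stable generator_stable f)
  have cont: "isCont W z" if "z \<in> \<Omega>" for z
    by (rule differentiable_imp_continuous_within[OF test_functions_differentiable[OF W(1) that]])
  have "\<bar>partial i (U t) y - partial i (U s) y\<bar> \<le> \<bar>t - s\<bar> * (\<bar>t - s\<bar> * W y)"
  proof (rule partial_increment_bound[where G = \<Omega> and V = V and K = "\<lambda>z. \<bar>t - s\<bar> * W z"])
    fix r z assume r: "r \<in> closed_segment s t" and z: "z \<in> \<Omega>"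
    have r': "r \<in> {0..T}" using seg r by blast
    have "((\<lambda>q. P q f z) has_real_derivative P r (L f) z) (at r within closed_segment s t)"
      using seg r' by (intro has_field_derivative_subset[OF forward[OF f z]]) auto
    then show "((\<lambda>q. U q z) has_real_derivative V r z) (at r within closed_segment s t)"
      unfolding U_def V_def by (rule DERIV_diff) (auto intro!: derivative_eq_intros)
    show "V r differentiable (at z)"
      unfolding V_def using d st r' z by (intro differentiable_diff) auto
    have "\<bar>partial i (V r) z\<bar> = \<bar>partial i (P r (L f)) z - partial i (P s (L f)) z\<bar>"
      unfolding V_def using d st r' z by (subst partial_diff) auto
    also have "\<dots> \<le> \<bar>r - s\<bar> * W z"
      by (rule gradient_increment[OF generator_stable[OF f] st(1) r' z cont[OF z] W(2)])
    also have "\<dots> \<le> \<bar>t - s\<bar> * W z"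
    proof (rule mult_right_mono)
      show "\<bar>r - s\<bar> \<le> \<bar>t - s\<bar>"
        using r by (auto simp: closed_segment_eq_real_ivl split: if_splits)
      show "0 \<le> W z" using W(2)[OF st(1) z] by linarith
    qed
    finally show "\<bar>partial i (V r) z\<bar> \<le> \<bar>t - s\<bar> * W z" .
  next
    show "isCont (\<lambda>z. \<bar>t - s\<bar> * W z) y"
      using cont[OF y] by (intro continuous_intros)
    show "U s differentiable (at y)" "U t differentiable (at y)"
      unfolding U_def using d st y
      by (auto intro!: differentiable_diff differentiable_mult differentiable_const)
  qed (use y open_domain in auto)
  moreover have "partial i (U r) y = partial i (P r f) y - r * partial i (P s (L f)) y"
    if "r \<in> {0..T}" for r
    unfolding U_def using d st that y
    by (subst partial_diff)
      (auto simp: partial_cmult intro!: differentiable_mult differentiable_const)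
  then have "partial i (U t) y - partial i (U s) y
      = partial i (P t f) y - partial i (P s f) y - (t - s) * partial i (P s (L f)) y"
    using st by (simp add: algebra_simps)
  moreover have "\<bar>t - s\<bar> * (\<bar>t - s\<bar> * W y) = (t - s)\<^sup>2 * W y"
    by (simp add: power2_eq_square flip: mult.assoc)
  ultimately show ?thesis by simp
qed


lemma generator_gradient_P:
  assumes "f \<in> \<A>" "y \<in> \<Omega>" "0 \<le> t"
  shows "partial i (P t (L f)) y = partial i (L (P t f)) y"
proof (rule partial_cong_open[OF _ open_domain assms(2)])
  show "P t (L f) differentiable (at y)"
    by (rule test_functions_differentiable[OF semigroup_stable[OF generator_stable[OF assms(1)] assms(3)] assms(2)])
  show "P t (L f) z = L (P t f) z" if "z \<in> \<Omega>" for z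
    using generator_P_commute[OF assms(1) that assms(3)] by simp
qed

text \<open>
  Near \<open>s\<close> the function \<open>h r\<close> is \<open>h s + (r - s) k\<close> up to \<open>(r - s)\<^sup>2 E\<close> with \<open>E\<close> a test function
  that does not depend on \<open>r\<close>. Hence \<open>P r (h r) x\<close> differs from \<open>P r (h s) x + (r - s) P r k x\<close>
  by a function \<open>R\<close> of order \<open>(r - s)\<^sup>2\<close>, and in the latter \<open>r\<close> occurs only as a time of the semigroup
  acting on fixed test functions, so that the forward equation differentiates it.
\<close>
lemma interpolation_derivative:
  assumes f: "f \<in> \<A>" and x: "x \<in> \<Omega>" and s: "s \<in> {0..T}"
  defines "g \<equiv> P (T - s) f"
  shows "((\<lambda>r. P r (\<lambda>y. (norm (grad (P (T - r) f) y))\<^sup>2) x) has_real_derivative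
    P s (\<lambda>y. L (\<lambda>z. (norm (grad g z))\<^sup>2) y - 2 * (grad g y \<bullet> grad (L g) y)) x) (at s within {0..T})"
proof -
  define h where "h r y = (norm (grad (P (T - r) f) y))\<^sup>2" for r y
  define k where "k y = (- 2) * (\<Sum>i\<in>UNIV. partial i g y * partial i (P (T - s) (L f)) y)" for y
  have PT: "P (T - r) f' \<in> \<A>" if "r \<in> {0..T}" "f' \<in> \<A>" for r f'
    using that by (intro semigroup_stable) auto
  have hA: "h r \<in> \<A>" if "r \<in> {0..T}" for r
    unfolding h_def by (rule norm_grad_squared_test_function[OF open_domain PT[OF that f]])
  have kA: "k \<in> \<A>"
    unfolding k_def g_def
    by (intro closed_under test_functions_partial PT s f generator_stable)
  obtain W0 where W0: "W0 \<in> \<A>" "\<And>y. 0 \<le> W0 y"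
    "\<And>i t y. t \<in> {0..T} \<Longrightarrow> y \<in> \<Omega> \<Longrightarrow> \<bar>partial i (P t f) y\<bar> \<le> W0 y"
    by (rule gradient_majorant[OF f, of T]) blast
  obtain W1 where W1: "W1 \<in> \<A>" "\<And>y. 0 \<le> W1 y"
    "\<And>i t y. t \<in> {0..T} \<Longrightarrow> y \<in> \<Omega> \<Longrightarrow> \<bar>partial i (P t (L f)) y\<bar> \<le> W1 y"
    by (rule gradient_majorant[OF generator_stable[OF f], of T]) blast
  obtain W2 where W2: "W2 \<in> \<A>" "\<And>y. 0 \<le> W2 y"
    "\<And>i t y. t \<in> {0..T} \<Longrightarrow> y \<in> \<Omega> \<Longrightarrow> \<bar>partial i (P t (L (L f))) y\<bar> \<le> W2 y"
    by (rule gradient_majorant[OF generator_stable[OF generator_stable[OF f]], of T]) blast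
  define E where "E y = real CARD('n) * (W1 y * W1 y + 2 * (W0 y * W2 y))" for y
  have EA: "E \<in> \<A>"
    unfolding E_def by (intro closed_under W0(1) W1(1) W2(1))
  have taylor: "\<bar>h r y - h s y - (r - s) * k y\<bar> \<le> (r - s)\<^sup>2 * E y"
    if r: "r \<in> {0..T}" and y: "y \<in> \<Omega>" for r y
  proof -
    let ?p = "\<lambda>r i. partial i (P (T - r) f) y"
    let ?q = "\<lambda>i. partial i (P (T - s) (L f)) y"
    have T: "T - s \<in> {0..T}" "T - r \<in> {0..T}" using s r by auto
    have termwise: "\<bar>(?p r i)\<^sup>2 - (?p s i)\<^sup>2 + 2 * (r - s) * (?p s i * ?q i)\<bar>
        \<le> (r - s)\<^sup>2 * (W1 y * W1 y + 2 * (W0 y * W2 y))" for i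
    proof -
      have "isCont W1 y"
        by (rule differentiable_imp_continuous_within[OF test_functions_differentiable[OF W1(1) y]])
      from gradient_increment[OF f T y this W1(3), of i]
      have a: "\<bar>?p r i - ?p s i\<bar> \<le> \<bar>r - s\<bar> * W1 y"
        by (simp add: abs_minus_commute)
      from gradient_taylor[OF f T y W2(1,3), of i]
      have b: "\<bar>?p r i - ?p s i + (r - s) * ?q i\<bar> \<le> (r - s)\<^sup>2 * W2 y"
        by (simp add: algebra_simps power2_commute[of s r])
      have c: "\<bar>?p s i\<bar> \<le> W0 y" by (rule W0(3)[OF T(1) y])
      \<comment> \<open>The sign of the linear term is opposite to that in \<open>gradient_taylor\<close> because time runs
        backwards in \<open>T - r\<close>.\<close>
      have "\<bar>(?p r i)\<^sup>2 - (?p s i)\<^sup>2 + 2 * (r - s) * (?p s i * ?q i)\<bar>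
          = \<bar>(?p r i - ?p s i) * (?p r i - ?p s i)
              + 2 * (?p s i * (?p r i - ?p s i + (r - s) * ?q i))\<bar>"
        by (rule arg_cong[where f = abs]) (simp add: power2_eq_square algebra_simps)
      also have "\<dots> \<le> \<bar>?p r i - ?p s i\<bar> * \<bar>?p r i - ?p s i\<bar>
          + 2 * (\<bar>?p s i\<bar> * \<bar>?p r i - ?p s i + (r - s) * ?q i\<bar>)"
        by (rule order_trans[OF abs_triangle_ineq]) (simp add: abs_mult)
      also have "\<dots> \<le> (\<bar>r - s\<bar> * W1 y) * (\<bar>r - s\<bar> * W1 y) + 2 * (W0 y * ((r - s)\<^sup>2 * W2 y))"
        using a b c W0(2)[of y] W1(2)[of y] by (intro add_mono mult_left_mono mult_mono) auto
      also have "\<dots> = (r - s)\<^sup>2 * (W1 y * W1 y + 2 * (W0 y * W2 y))"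
      proof -
        have "(\<bar>r - s\<bar> * W1 y) * (\<bar>r - s\<bar> * W1 y) = (\<bar>r - s\<bar> * \<bar>r - s\<bar>) * (W1 y * W1 y)"
          by (simp only: mult_ac)
        also have "\<bar>r - s\<bar> * \<bar>r - s\<bar> = (r - s)\<^sup>2"
          by (simp add: power2_eq_square)
        finally show ?thesis by (simp add: distrib_left mult_ac)
      qed
      finally show ?thesis .
    qed
    have "\<bar>h r y - h s y - (r - s) * k y\<bar>
        = \<bar>\<Sum>i\<in>UNIV. (?p r i)\<^sup>2 - (?p s i)\<^sup>2 + 2 * (r - s) * (?p s i * ?q i)\<bar>"
      unfolding h_def k_def g_def norm_grad_squared
      by (rule arg_cong[where f = abs])
        (simp add: sum.distrib sum_subtractf sum_distrib_left algebra_simps)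
    also have "\<dots> \<le> (\<Sum>i\<in>(UNIV :: 'n set). (r - s)\<^sup>2 * (W1 y * W1 y + 2 * (W0 y * W2 y)))"
      by (rule order_trans[OF sum_abs sum_mono[OF termwise]])
    also have "\<dots> = (r - s)\<^sup>2 * E y"
      by (simp add: E_def mult_ac)
    finally show ?thesis .
  qed
  obtain B where B: "\<And>r. r \<in> {0..T} \<Longrightarrow> \<bar>P r E x\<bar> \<le> B"
    by (rule P_bounded[OF EA x, of T]) blast
  define R where "R r = P r (h r) x - (P r (h s) x + (r - s) * P r k x)" for r
  have R: "\<bar>R r\<bar> \<le> (r - s)\<^sup>2 * B" if r: "r \<in> {0..T}" for r
  proof -
    have r0: "0 \<le> r" using r by simp
    have m: "(\<lambda>y. (- 1) * h s y) \<in> \<A>" "(\<lambda>y. (- (r - s)) * k y) \<in> \<A>"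
      by (intro closed_under hA s kA)+
    have "\<bar>R r\<bar> = \<bar>P r (\<lambda>y. h r y + ((- 1) * h s y + (- (r - s)) * k y)) x\<bar>"
      unfolding R_def P_add[OF x r0 hA[OF r] test_functions_add[OF open_domain m]]
        P_add[OF x r0 m] P_cmult by (simp add: algebra_simps)
    also have "\<dots> \<le> P r (\<lambda>y. (r - s)\<^sup>2 * E y) x"
    proof (rule P_abs_le[OF x r0])
      show "(\<lambda>y. h r y + ((- 1) * h s y + (- (r - s)) * k y)) \<in> \<A>"
        by (intro test_functions_add[OF open_domain] m hA r)
      show "(\<lambda>y. (r - s)\<^sup>2 * E y) \<in> \<A>" by (intro test_functions_cmult[OF open_domain] EA)
      show "\<bar>h r y + ((- 1) * h s y + (- (r - s)) * k y)\<bar> \<le> (r - s)\<^sup>2 * E y" if "y \<in> \<Omega>" for y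
        using taylor[OF r that] by (simp add: algebra_simps)
    qed
    also have "\<dots> \<le> (r - s)\<^sup>2 * B"
      unfolding P_cmult using B[OF r] by (intro mult_left_mono) auto
    finally show ?thesis .
  qed
  have "(R has_real_derivative 0) (at s within {0..T})"
    unfolding has_field_derivative_iff
  proof (rule Lim_null_comparison)
    have "R s = 0" by (simp add: R_def)
    have "norm ((R r - R s) / (r - s)) \<le> \<bar>r - s\<bar> * B" if r: "r \<in> {0..T}" "r \<noteq> s" for r
    proof -
      have "\<bar>R r\<bar> \<le> \<bar>r - s\<bar> * (\<bar>r - s\<bar> * B)"
        using R[OF r(1)] by (simp add: power2_eq_square flip: mult.assoc)
      then show ?thesis
        using r(2) \<open>R s = 0\<close> by (simp add: divide_le_eq mult_ac)
    qed
    then show "\<forall>\<^sub>F r in at s within {0..T}. norm ((R r - R s) / (r - s)) \<le> \<bar>r - s\<bar> * B"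
      by (auto simp: eventually_at_filter)
    have "((\<lambda>r. \<bar>r - s\<bar> * B) \<longlongrightarrow> \<bar>s - s\<bar> * B) (at s within {0..T})"
      by (intro tendsto_intros)
    then show "((\<lambda>r. \<bar>r - s\<bar> * B) \<longlongrightarrow> 0) (at s within {0..T})" by simp
  qed
  moreover have fwd: "((\<lambda>r. P r f' x) has_real_derivative P s (L f') x) (at s within {0..T})"
    if "f' \<in> \<A>" for f'
    using s by (intro has_field_derivative_subset[OF forward[OF that x]]) auto
  moreover have "((\<lambda>r. (r - s) * P r k x) has_real_derivative P s k x) (at s within {0..T})"
    by (rule DERIV_cong[OF DERIV_mult[OF _ fwd[OF kA], of "\<lambda>r. r - s" 1]])
      (auto intro!: derivative_eq_intros)
  ultimately have "((\<lambda>r. R r + (P r (h s) x + (r - s) * P r k x)) has_real_derivative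
      0 + (P s (L (h s)) x + P s k x)) (at s within {0..T})"
    by (intro DERIV_add fwd hA s)
  moreover have "(\<lambda>r. R r + (P r (h s) x + (r - s) * P r k x)) = (\<lambda>r. P r (h r) x)"
    by (simp add: R_def fun_eq_iff)
  moreover have "0 + (P s (L (h s)) x + P s k x)
      = P s (\<lambda>y. L (\<lambda>z. (norm (grad g z))\<^sup>2) y - 2 * (grad g y \<bullet> grad (L g) y)) x"
  proof -
    have s0: "0 \<le> s" "0 \<le> T - s" using s by auto
    have "0 + (P s (L (h s)) x + P s k x) = P s (\<lambda>y. L (h s) y + k y) x"
      using P_add[OF x s0(1) generator_stable[OF hA[OF s]] kA] by simp
    also have "\<dots> = P s (\<lambda>y. L (\<lambda>z. (norm (grad g z))\<^sup>2) y - 2 * (grad g y \<bullet> grad (L g) y)) x"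
    proof (rule P_cong[OF x s0(1)])
      fix y assume y: "y \<in> \<Omega>"
      have "k y = - 2 * (grad g y \<bullet> grad (L g) y)"
        unfolding k_def g_def generator_gradient_P[OF f y s0(2)] by (simp add: inner_vec_def grad_def)
      moreover have "h s = (\<lambda>z. (norm (grad g z))\<^sup>2)"
        unfolding h_def g_def ..
      ultimately show "L (h s) y + k y = L (\<lambda>z. (norm (grad g z))\<^sup>2) y - 2 * (grad g y \<bullet> grad (L g) y)"
        by simp
    qed
    finally show ?thesis .
  qed
  ultimately show ?thesis unfolding h_def by metis
qed


section \<open>The differential inequality\<close>
lemma smooth_on_differentiable:
  assumes "smooth_on S f" "x \<in> S"
  shows "f differentiable (at x)"
proof -
  have "partials [] f differentiable (at x)"
    using assms unfolding smooth_on_def by blast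
  then show ?thesis by (simp add: partials_Nil)
qed

text \<open>
  Not a formality: the Kolmogorov equations do not determine \<open>P 0\<close>. The process starts at \<open>x\<close> unless
  the first waiting time \<open>S 0\<close> vanishes, and \<open>S 0 < s\<close> has probability \<open>1 - e\<^sup>-\<^sup>c\<^sup>s \<le> c s\<close>, which
  tends to \<open>0\<close> with \<open>s\<close>.
\<close>
lemma P_0:
  assumes const: "\<And>y. y \<in> \<Omega> \<Longrightarrow> lam y = c" and f: "f \<in> \<A>" and x: "x \<in> \<Omega>"
  shows "P 0 f x = f x"
proof -
  from process[OF x] obtain Y S where jc: "jump_chain \<Omega> lam Q \<phi> x (N x) Y S"
    and path: "AE \<omega> in N x. \<forall>n. \<forall>t\<ge>0.
        jump_time S n \<omega> \<le> ennreal t \<and> ennreal t < jump_time S (Suc n) \<omega> \<longrightarrow>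
        X x t \<omega> = \<phi> (Y n \<omega>) (t - enn2real (jump_time S n \<omega>))"
    unfolding pdmp_from_def by blast
  from jc interpret prob_space "N x" unfolding jump_chain_def by blast
  have Y: "\<And>n. Y n \<in> N x \<rightarrow>\<^sub>M restrict_space borel \<Omega>" and S[measurable]: "\<And>n. S n \<in> borel_measurable (N x)"
    and Y0: "AE \<omega> in N x. Y 0 \<omega> = x"
    and S0: "\<And>s. 0 \<le> s \<Longrightarrow> AE \<omega> in N x.
      real_cond_exp (N x) (history \<Omega> (N x) Y S 0 0)
          (indicator {\<omega> \<in> space (N x). S 0 \<omega> < ennreal s}) \<omega>
        = 1 - exp (- integral {0..s} (\<lambda>w. lam (\<phi> (Y 0 \<omega>) w)))"
    using jc unfolding jump_chain_def by blast+
  let ?F = "history \<Omega> (N x) Y S 0 0"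
  let ?A = "\<lambda>s. {\<omega> \<in> space (N x). S 0 \<omega> < ennreal s}"
  let ?G = "{Y k -` B \<inter> space (N x) | k B. k \<le> 0 \<and> B \<in> sets (restrict_space borel \<Omega>)} \<union>
     {S k -` B \<inter> space (N x) | k B. k < (0::nat) \<and> B \<in> sets borel}"
  have G: "?G \<subseteq> sets (N x)"
    using measurable_sets[OF Y] by auto
  then have GP: "?G \<subseteq> Pow (space (N x))"
    using sets.space_closed[of "N x"] by (rule subset_trans)
  have "subalgebra (N x) ?F"
    unfolding subalgebra_def history_def sets_measure_of[OF GP] space_measure_of[OF GP]
    using sets.sigma_sets_subset[OF G] by simp
  then interpret finite_measure_subalgebra "N x" ?F
    by unfold_locales
  have jump_prob: "prob (?A s) = 1 - exp (- c * s)" if s: "0 \<le> s" for s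
  proof -
    have [measurable]: "?A s \<in> sets (N x)" by measurable
    have "AE \<omega> in N x. real_cond_exp (N x) ?F (indicator (?A s)) \<omega> = 1 - exp (- c * s)"
      using S0[OF s] Y0
    proof eventually_elim
      case (elim \<omega>)
      have "integral {0..s} (\<lambda>w. lam (\<phi> x w)) = integral {0..s} (\<lambda>w. c)"
        by (rule Henstock_Kurzweil_Integration.integral_cong) (use x flow_in const in auto)
      with elim s show ?case by (simp add: mult.commute)
    qed
    then have "(\<integral>\<omega>. real_cond_exp (N x) ?F (indicator (?A s)) \<omega> \<partial>N x) = (\<integral>\<omega>. 1 - exp (- c * s) \<partial>N x)"
      by (intro integral_cong_AE) auto
    moreover have "(\<integral>\<omega>. real_cond_exp (N x) ?F (indicator (?A s)) \<omega> \<partial>N x) = (\<integral>\<omega>. indicator (?A s) \<omega> \<partial>N x)"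
      by (rule real_cond_exp_int(2)) (auto simp: emeasure_eq_measure)
    ultimately show ?thesis by (simp add: prob_space)
  qed
  let ?Z = "{\<omega> \<in> space (N x). S 0 \<omega> = 0}"
  have Z: "?Z \<in> sets (N x)" by measurable
  have "prob ?Z \<le> 0 + e" if e: "0 < e" for e
  proof -
    define s where "s = e / (\<bar>c\<bar> + 1)"
    have s: "0 < s" "c * s \<le> e"
    proof -
      show "0 < s" using e by (simp add: s_def)
      have "c * s \<le> (\<bar>c\<bar> + 1) * s" using \<open>0 < s\<close> by (intro mult_right_mono) auto
      then show "c * s \<le> e" by (simp add: s_def)
    qed
    have "prob ?Z \<le> prob (?A s)"
      using s(1) by (intro finite_measure_mono) auto
    also have "\<dots> = 1 - exp (- c * s)" using s by (intro jump_prob) simp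
    also have "\<dots> \<le> c * s" using exp_ge_add_one_self[of "- c * s"] by simp
    finally show ?thesis using s(2) by simp
  qed
  then have "prob ?Z \<le> 0" by (rule field_le_epsilon)
  then have "prob ?Z = 0" by (simp add: measure_le_0_iff)
  then have "AE \<omega> in N x. \<omega> \<notin> ?Z"
    using Z by (intro AE_not_in) (auto simp: null_sets_def emeasure_eq_measure)
  then have "AE \<omega> in N x. X x 0 \<omega> = x"
    using Y0 path AE_space
  proof eventually_elim
    case (elim \<omega>)
    have "0 < S 0 \<omega>" using elim(1,4) by (simp add: zero_less_iff_neq_zero)
    then have "X x 0 \<omega> = \<phi> (Y 0 \<omega>) (0 - enn2real (jump_time S 0 \<omega>))"
      using elim(3)[rule_format, of 0 0] by (simp add: jump_time_def)
    then show ?case using elim(2) flow_0[OF x] by (simp add: jump_time_def)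
  qed
  then have "AE \<omega> in N x. f (X x 0 \<omega>) = f x"
    by eventually_elim simp
  then have "(\<integral>\<omega>. f (X x 0 \<omega>) \<partial>N x) = (\<integral>\<omega>. f x \<partial>N x)"
    using semigroup_integrable[OF f x order_refl] by (intro integral_cong_AE) auto
  then show ?thesis by (simp add: semigroup_op_def prob_space)
qed

lemma test_function_mixed_partials:
  assumes "g \<in> \<A>" "y \<in> \<Omega>"
  shows "partial j (partial i g) y = partial i (partial j g) y"
proof (rule mixed_partials_commute[OF open_domain assms(2)])
  show "isCont (partial i (partial j g)) y"
    by (rule differentiable_imp_continuous_within[OF test_functions_differentiable[OF _ assms(2)]])
      (intro test_functions_partial assms)
qed (use assms in \<open>auto intro: test_functions_differentiable test_functions_partial\<close>)

text \<open>
  The transport part \<open>b \<bullet> \<nabla>\<close> of the generator is a derivation: its contributions to \<open>L|\<nabla>g|\<^sup>2\<close> and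
  to \<open>2 \<nabla>g \<bullet> \<nabla>Lg\<close> containing second derivatives of \<open>g\<close> are equal by symmetry of the Hessian,
  and only the derivative of \<open>b\<close> survives. The constant rate is used in \<open>\<nabla>(c (Qg - g))\<close>, which
  would otherwise contain the gradient of the rate.
\<close>
lemma gradient_energy_commutator:
  assumes const: "\<And>y. y \<in> \<Omega> \<Longrightarrow> lam y = c" and g: "g \<in> \<A>" and y: "y \<in> \<Omega>"
  shows "L (\<lambda>z. (norm (grad g z))\<^sup>2) y - 2 * (grad g y \<bullet> grad (L g) y)
    = c * (kernel_op Q (\<lambda>z. (norm (grad g z))\<^sup>2) y + (norm (grad g y))\<^sup>2
        - 2 * (grad g y \<bullet> grad (kernel_op Q g) y))
      - 2 * (grad g y \<bullet> (J_mat b y *v grad g y))"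
proof -
  let ?h = "\<lambda>z. (norm (grad g z))\<^sup>2"
  let ?D = "\<lambda>i. partial i g y" and ?DD = "\<lambda>i k. partial i (partial k g) y"
  have d: "\<And>f. f \<in> \<A> \<Longrightarrow> f differentiable (at y)"
    using test_functions_differentiable y by blast
  note dg = d[OF test_functions_partial[OF g]]
  have db: "(\<lambda>z. b z $ k) differentiable (at y)" for k
    by (rule smooth_on_differentiable[OF smooth_b y])
  have grad_h: "grad ?h y $ k = (\<Sum>i\<in>UNIV. 2 * (?D i * ?DD i k))" for k
  proof -
    have "grad ?h y $ k = partial k (\<lambda>z. \<Sum>i\<in>UNIV. partial i g z * partial i g z) y"
      \<comment> \<open>In two stages, lest the square of the norm be expanded first.\<close>
      unfolding norm_grad_squared unfolding power2_eq_square grad_def by simp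
    also have "\<dots> = (\<Sum>i\<in>UNIV. 2 * (?D i * ?DD k i))"
      using dg by (subst partial_sum) (auto simp: partial_mult intro!: differentiable_mult)
    finally show ?thesis
      using test_function_mixed_partials[OF g y, of k] by simp
  qed
  have grad_L: "grad (L g) y $ i = (\<Sum>k\<in>UNIV. b y $ k * ?DD i k + J_mat b y $ i $ k * ?D k)
      + c * (partial i (kernel_op Q g) y - ?D i)" for i
  proof -
    let ?F = "\<lambda>z. (\<Sum>k\<in>UNIV. b z $ k * partial k g z) + c * (kernel_op Q g z - g z)"
    have dQ: "(\<lambda>z. kernel_op Q g z - g z) differentiable (at y)"
      by (intro differentiable_diff d kernel_stable g)
    have ds: "(\<lambda>z. \<Sum>k\<in>UNIV. b z $ k * partial k g z) differentiable (at y)"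
      by (intro differentiable_sum differentiable_mult db dg finite ballI)
    have dc: "(\<lambda>z. c * (kernel_op Q g z - g z)) differentiable (at y)"
      by (intro differentiable_mult dQ differentiable_const)
    have "partial i ?F y = partial i (L g) y"
    proof (rule partial_cong_open[OF _ open_domain y])
      show "?F differentiable (at y)" by (intro differentiable_add ds dc)
      show "?F z = L g z" if "z \<in> \<Omega>" for z
        using const[OF that] by (simp add: generator_def inner_vec_def grad_def)
    qed
    moreover have "partial i ?F y = (\<Sum>k\<in>UNIV. b y $ k * ?DD i k + J_mat b y $ i $ k * ?D k)
      + c * (partial i (kernel_op Q g) y - ?D i)"
      unfolding partial_add[OF ds dc] partial_cmult[OF dQ]
        partial_diff[OF d[OF kernel_stable[OF g]] d[OF g]]
        partial_sum[OF differentiable_mult[OF db dg]] partial_mult[OF db dg]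
      by (simp add: J_mat_def)
    ultimately show ?thesis by (simp add: grad_def)
  qed
  have transport: "b y \<bullet> grad ?h y = 2 * (\<Sum>i\<in>UNIV. \<Sum>k\<in>UNIV. ?D i * (b y $ k * ?DD i k))"
    unfolding inner_vec_def grad_h
    by (subst sum.swap[symmetric]) (simp add: sum_distrib_left mult_ac)
  have "grad g y \<bullet> grad (L g) y
      = (\<Sum>i\<in>UNIV. \<Sum>k\<in>UNIV. ?D i * (b y $ k * ?DD i k))
        + (\<Sum>i\<in>UNIV. \<Sum>k\<in>UNIV. ?D i * (J_mat b y $ i $ k * ?D k))
        + c * (grad g y \<bullet> grad (kernel_op Q g) y - ?h y)"
    unfolding inner_vec_def grad_L norm_grad_squared
    by (simp add: grad_def sum.distrib sum_subtractf sum_distrib_left algebra_simps power2_eq_square)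
  moreover have "grad g y \<bullet> (J_mat b y *v grad g y)
      = (\<Sum>i\<in>UNIV. \<Sum>k\<in>UNIV. ?D i * (J_mat b y $ i $ k * ?D k))"
    by (simp add: inner_vec_def matrix_vector_mult_def grad_def sum_distrib_left)
  moreover have "L ?h y = b y \<bullet> grad ?h y + c * (kernel_op Q ?h y - ?h y)"
    by (simp add: generator_def const[OF y])
  ultimately show ?thesis
    unfolding transport by (simp add: algebra_simps)
qed

lemma kernel_prob_space:
  assumes "x \<in> \<Omega>"
  shows "prob_space (Q x)"
  using measurable_space[OF kernel, of x] assms
  by (simp add: space_restrict_space space_prob_algebra)

text \<open>
  Coordinates have a gradient of norm one, and \<open>Q x\<close> has total mass one, so for a coordinate function
  the right hand side of the gradient bound is the constant \<open>m\<close> itself.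
\<close>
lemma gradient_constant_nonneg:
  fixes m :: real
  assumes x: "x \<in> \<Omega>"
    and bound: "\<And>f. f \<in> \<A> \<Longrightarrow>
      (norm (grad (kernel_op Q f) x))\<^sup>2 \<le> m * kernel_op Q (\<lambda>y. (norm (grad f y))\<^sup>2) x"
  shows "0 \<le> m"
proof -
  fix j :: 'n
  interpret prob_space "Q x" by (rule kernel_prob_space[OF x])
  have "(norm (grad (\<lambda>y :: real ^ 'n. y $ j) y))\<^sup>2 = 1" for y
    by (simp add: norm_grad_squared partial_coordinate if_distrib[of "\<lambda>t. t\<^sup>2"] cong: if_cong)
  then have "kernel_op Q (\<lambda>y. (norm (grad (\<lambda>y. y $ j) y))\<^sup>2) x = 1"
    by (simp add: kernel_op_def prob_space)
  then show ?thesis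
    using order_trans[OF zero_le_power2 bound[OF test_functions_coordinate[OF open_domain, of j]]]
    by simp
qed

text \<open>
  The cross term is absorbed by comparing squares:
  \<open>(2 u \<bullet> v)\<^sup>2 \<le> 4 |u|\<^sup>2 |v|\<^sup>2 \<le> 4 (m |u|\<^sup>2) q \<le> (m |u|\<^sup>2 + q)\<^sup>2\<close>. Recovering the unsquared inequality
  needs \<open>m \<ge> 0\<close>, which is a consequence of the gradient bound.
\<close>
lemma dissipation_lower_bound:
  assumes const: "\<And>y. y \<in> \<Omega> \<Longrightarrow> lam y = c" and g: "g \<in> \<A>" and y: "y \<in> \<Omega>"
    and gradient_Q: "\<And>f. f \<in> \<A> \<Longrightarrow>
      (norm (grad (kernel_op Q f) y))\<^sup>2 \<le> m * kernel_op Q (\<lambda>z. (norm (grad f z))\<^sup>2) y"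
    and contraction: "\<And>u. 2 * (u \<bullet> (J_mat b y *v u)) + c * (m - 1) * (norm u)\<^sup>2 \<le> - \<eta> * (norm u)\<^sup>2"
  shows "\<eta> * (norm (grad g y))\<^sup>2
    \<le> L (\<lambda>z. (norm (grad g z))\<^sup>2) y - 2 * (grad g y \<bullet> grad (L g) y)"
proof -
  let ?u = "grad g y" and ?v = "grad (kernel_op Q g) y"
  let ?q = "kernel_op Q (\<lambda>z. (norm (grad g z))\<^sup>2) y"
  have m: "0 \<le> m" by (rule gradient_constant_nonneg[OF y gradient_Q])
  have q: "0 \<le> ?q" unfolding kernel_op_def by (rule Bochner_Integration.integral_nonneg) simp
  have "2 * (?u \<bullet> ?v) \<le> m * (norm ?u)\<^sup>2 + ?q"
  proof (rule power2_le_imp_le)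
    have "(2 * (?u \<bullet> ?v))\<^sup>2 = 4 * (?u \<bullet> ?v)\<^sup>2" by (simp add: power2_eq_square)
    also have "\<dots> \<le> 4 * ((norm ?u)\<^sup>2 * (norm ?v)\<^sup>2)"
      using Cauchy_Schwarz_ineq[of ?u ?v] by (simp add: power2_norm_eq_inner)
    also have "\<dots> \<le> 4 * ((norm ?u)\<^sup>2 * (m * ?q))"
      using gradient_Q[OF g] by (intro mult_left_mono) auto
    also have "\<dots> \<le> (m * (norm ?u)\<^sup>2 + ?q)\<^sup>2"
      using zero_le_power2[of "m * (norm ?u)\<^sup>2 - ?q"]
      by (simp add: power2_sum power2_diff mult_ac)
    finally show "(2 * (?u \<bullet> ?v))\<^sup>2 \<le> (m * (norm ?u)\<^sup>2 + ?q)\<^sup>2" .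
    show "0 \<le> m * (norm ?u)\<^sup>2 + ?q" using m q by simp
  qed
  moreover have "0 \<le> c" using rate_nonneg[OF y] const[OF y] by simp
  ultimately have "c * (2 * (?u \<bullet> ?v)) \<le> c * (m * (norm ?u)\<^sup>2 + ?q)"
    by (rule mult_left_mono)
  then show ?thesis
    using contraction[of ?u] gradient_energy_commutator[OF const g y]
    by (simp add: algebra_simps)
qed

end

theorem theorem1:
  fixes \<Omega> :: "(real ^ 'n) set"
    and b :: "real ^ 'n \<Rightarrow> real ^ 'n"
    and lam :: "real ^ 'n \<Rightarrow> real"
    and Q :: "real ^ 'n \<Rightarrow> (real ^ 'n) measure"
    and \<phi> :: "real ^ 'n \<Rightarrow> real \<Rightarrow> real ^ 'n"
    and N :: "real ^ 'n \<Rightarrow> 'w measure"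
    and X :: "real ^ 'n \<Rightarrow> real \<Rightarrow> 'w \<Rightarrow> real ^ 'n"
    and \<mu> :: "(real ^ 'n) measure"
    and M :: "real ^ 'n \<Rightarrow> real"
    and \<eta> :: real
  assumes setting: "pdmp_setting \<Omega> b lam Q \<phi> N X \<mu>"
    and constant_rate: "lam constant_on \<Omega>"
    and gradient_Q: "\<forall>f\<in>test_functions \<Omega>. \<forall>x\<in>\<Omega>.
      (norm (grad (kernel_op Q f) x))\<^sup>2 \<le> M x * kernel_op Q (\<lambda>y. (norm (grad f y))\<^sup>2) x"
    and contraction: "\<forall>x\<in>\<Omega>. \<forall>u.
      2 * (u \<bullet> (J_mat b x *v u)) + lam x * (M x - 1) * (norm u)\<^sup>2 \<le> - \<eta> * (norm u)\<^sup>2"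
  shows "\<forall>t>0. \<forall>f\<in>test_functions \<Omega>. \<forall>x\<in>\<Omega>.
    (norm (grad (semigroup_op N X t f) x))\<^sup>2
      \<le> exp (- \<eta> * t) * semigroup_op N X t (\<lambda>y. (norm (grad f y))\<^sup>2) x"
proof (intro allI impI ballI)
  fix t :: real and f x
  assume t: "0 < t" and f: "f \<in> test_functions \<Omega>" and x: "x \<in> \<Omega>"
  interpret pdmp_setting \<Omega> b lam Q \<phi> N X \<mu> by (rule setting)
  obtain c where c: "\<And>y. y \<in> \<Omega> \<Longrightarrow> lam y = c"
    using constant_rate unfolding constant_on_def by blast
  define h where "h s y = (norm (grad (P (t - s) f) y))\<^sup>2" for s y
  define k where "k s y = L (h s) y - 2 * (grad (P (t - s) f) y \<bullet> grad (L (P (t - s) f)) y)" for s y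
  define \<psi> where "\<psi> s = exp (- \<eta> * s) * P s (h s) x" for s
  have PT: "P (t - s) f \<in> \<A>" if "s \<in> {0..t}" for s
    using that f by (intro semigroup_stable) auto
  have hA: "h s \<in> \<A>" if "s \<in> {0..t}" for s
    unfolding h_def by (rule norm_grad_squared_test_function[OF open_domain PT[OF that]])
  have kA: "k s \<in> \<A>" if "s \<in> {0..t}" for s
  proof -
    have "k s = (\<lambda>y. L (h s) y + (- 2) * (\<Sum>i\<in>UNIV. partial i (P (t - s) f) y * partial i (L (P (t - s) f)) y))"
      by (simp add: k_def inner_vec_def grad_def fun_eq_iff)
    then show ?thesis
      by (simp only:) (intro closed_under test_functions_partial generator_stable hA PT that)
  qed
  have energy: "\<eta> * h s y \<le> k s y" if s: "s \<in> {0..t}" and y: "y \<in> \<Omega>" for s y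
    unfolding h_def k_def
    by (rule dissipation_lower_bound[OF c PT[OF s] y, of "M y"])
      (use gradient_Q contraction y c[OF y] in auto)
  have deriv: "(\<psi> has_real_derivative exp (- \<eta> * s) * (P s (k s) x - \<eta> * P s (h s) x)) (at s within {0..t})"
    if s: "s \<in> {0..t}" for s
  proof -
    have "((\<lambda>r. P r (h r) x) has_real_derivative P s (k s) x) (at s within {0..t})"
      using interpolation_derivative[OF f x s] unfolding h_def k_def .
    then show ?thesis
      unfolding \<psi>_def by (auto intro!: derivative_eq_intros simp: algebra_simps)
  qed
  have nonneg: "0 \<le> exp (- \<eta> * s) * (P s (k s) x - \<eta> * P s (h s) x)" if s: "s \<in> {0..t}" for s
  proof -
    have "P s (\<lambda>y. \<eta> * h s y) x \<le> P s (k s) x"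
      using s by (intro P_mono x closed_under hA kA energy) auto
    then show ?thesis by (simp add: P_cmult)
  qed
  have "\<psi> 0 \<le> \<psi> t"
  proof (rule DERIV_nonneg_imp_increasing_open[where f = \<psi> and a = 0 and b = t])
    show "continuous_on {0..t} \<psi>"
      by (rule DERIV_continuous_on[OF deriv])
    show "\<exists>D. (\<psi> has_real_derivative D) (at s) \<and> 0 \<le> D" if "0 < s" "s < t" for s
      using deriv[of s] nonneg[of s] that at_within_Icc_at[OF that] by auto
  qed (use t in simp)
  moreover have "\<psi> 0 = (norm (grad (P t f) x))\<^sup>2"
    unfolding \<psi>_def using P_0[OF c hA x, of 0] t by (simp add: h_def)
  moreover have "\<psi> t = exp (- \<eta> * t) * P t (\<lambda>y. (norm (grad f y))\<^sup>2) x"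
  proof -
    have "(norm (grad (P 0 f) y))\<^sup>2 = (norm (grad f y))\<^sup>2" if y: "y \<in> \<Omega>" for y
    proof -
      have "partial i (P 0 f) y = partial i f y" for i
        using test_functions_differentiable[OF f y] P_0[OF c f]
        by (intro partial_cong_open[OF _ open_domain y, symmetric]) auto
      then show ?thesis by (simp add: grad_def)
    qed
    then have "P t (h t) x = P t (\<lambda>y. (norm (grad f y))\<^sup>2) x"
      using t x by (intro P_cong) (auto simp: h_def)
    then show ?thesis by (simp add: \<psi>_def)
  qed
  ultimately show "(norm (grad (P t f) x))\<^sup>2 \<le> exp (- \<eta> * t) * P t (\<lambda>y. (norm (grad f y))\<^sup>2) x"
    by simp
qed

end
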